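(* Let $\Gamma$ be a countable discrete amenable group. If a topological dynamical system $(X,\Gamma)$ is an extension of a free dynamical system with the small boundary property, then $(X,\Gamma)$ has the Uniform Rokhlin Property (URP). In particular, if $(X,\Gamma)$ is an extension of a free minimal Cantor system, then $(X,\Gamma)$ has the (URP).
   Context: A topological dynamical system $(X,\Gamma)$ consists of a separable compact Hausdorff (metrizable) space $X$ and a right action $(x,\gamma)\mapsto x\gamma$ of $\Gamma$ on $X$ by homeomorphisms; it is free if $x\gamma=x$ implies $\gamma=e$, minimal if $\varnothing$ and $X$ are the only closed invariant sets, and a Cantor system if $X$ is a Cantor set. $(X,\Gamma)$ is an extension of $(Y,\Gamma)$ if there is a $\Gamma$-equivariant continuous surjection $X\to Y$. $(Y,\Gamma)$ has the small boundary property if $Y$ has a basis of open sets $U$ with $\mu(\partial U)=0$ for every $\Gamma$-invariant Borel probability measure $\mu$ on $Y$. A finite set $F\subseteq\Gamma$ is $(K,\varepsilon)$-invariant ($K\subseteq\Gamma$ finite, $\varepsilon>0$) if $|FK\Delta F|/|F|<\varepsilon$. A Følner sequence $(\Gamma_n)$ is a sequence of finite subsets of $\Gamma$ that are eventually $(K,\varepsilon)$-invariant for every $(K,\varepsilon)$. For $E\subseteq X$, $\mathrm{ocap}(E)=\lim_n\frac1{|\Gamma_n|}\sup_{x\in X}\sum_{\gamma\in\Gamma_n}\chi_E(x\gamma)$ (independent of the Følner sequence). (URP): for every $\varepsilon>0$ and finite $K\subseteq\Gamma$ there exist closed sets $B_1,\dots,B_S\subseteq X$ and $(K,\varepsilon)$-invariant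 finite sets $\Gamma_1,\dots,\Gamma_S\subseteq\Gamma$ such that the sets $B_s\gamma$ ($\gamma\in\Gamma_s$, $s=1,\dots,S$) are mutually disjoint and $\mathrm{ocap}(X\setminus\bigsqcup_s\bigsqcup_{\gamma\in\Gamma_s}B_s\gamma)<\varepsilon$. *)

theory Defs
  imports "HOL-Probability.Probability" "HOL-Algebra.Coset"
begin

text \<open>
  The group \<open>\<Gamma>\<close> is a HOL-Algebra group \<open>G\<close>; phase spaces are types of class \<open>metric_space\<close>
  (no definition refers to the metric itself, only to the topology).
  A right action is a function \<open>act\<close> with \<open>act x g\<close> standing for \<open>x g\<close>; only its values for
  \<open>g \<in> carrier G\<close> matter.
\<close>

text \<open>Nonemptiness of \<open>F\<close> makes the quotient meaningful (in HOL, \<open>0 / 0 = 0\<close>).\<close>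

definition KE_invariant :: "('g, 'm) monoid_scheme \<Rightarrow> 'g set \<Rightarrow> real \<Rightarrow> 'g set \<Rightarrow> bool" where
  "KE_invariant G K \<epsilon> F \<longleftrightarrow>
     finite F \<and> F \<noteq> {} \<and> F \<subseteq> carrier G \<and>
     real (card (sym_diff (F <#>\<^bsub>G\<^esub> K) F)) / real (card F) < \<epsilon>"

text \<open>
  Wherever the pairs \<open>(K, \<epsilon>)\<close> are quantified, \<open>K\<close> is nonempty: for \<open>K = {}\<close> the quotient above
  equals 1, so that no set would be \<open>({}, \<epsilon>)\<close>-invariant for \<open>\<epsilon> \<le> 1\<close>.
\<close>

definition folner_sequence :: "('g, 'm) monoid_scheme \<Rightarrow> (nat \<Rightarrow> 'g set) \<Rightarrow> bool" where
  "folner_sequence G F \<longleftrightarrow>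
     (\<forall>n. finite (F n) \<and> F n \<subseteq> carrier G) \<and>
     (\<forall>K \<epsilon>. finite K \<and> K \<noteq> {} \<and> K \<subseteq> carrier G \<and> \<epsilon> > 0 \<longrightarrow>
        (\<forall>\<^sub>F n in sequentially. KE_invariant G K \<epsilon> (F n)))"

definition amenable_group :: "('g, 'm) monoid_scheme \<Rightarrow> bool" where
  "amenable_group G \<longleftrightarrow> group G \<and> (\<exists>F. folner_sequence G F)"

definition dyn_system ::
    "('g, 'm) monoid_scheme \<Rightarrow> ('x::metric_space \<Rightarrow> 'g \<Rightarrow> 'x) \<Rightarrow> bool" where
  "dyn_system G act \<longleftrightarrow>
     compact (UNIV :: 'x set) \<and>
     (\<forall>g\<in>carrier G. \<exists>h. homeomorphism UNIV UNIV (\<lambda>x. act x g) h) \<and>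
     (\<forall>x. act x \<one>\<^bsub>G\<^esub> = x) \<and>
     (\<forall>x. \<forall>g\<in>carrier G. \<forall>h\<in>carrier G. act x (g \<otimes>\<^bsub>G\<^esub> h) = act (act x g) h)"

definition free_system ::
    "('g, 'm) monoid_scheme \<Rightarrow> ('x::metric_space \<Rightarrow> 'g \<Rightarrow> 'x) \<Rightarrow> bool" where
  "free_system G act \<longleftrightarrow> (\<forall>x. \<forall>g\<in>carrier G. act x g = x \<longrightarrow> g = \<one>\<^bsub>G\<^esub>)"

definition minimal_system ::
    "('g, 'm) monoid_scheme \<Rightarrow> ('x::metric_space \<Rightarrow> 'g \<Rightarrow> 'x) \<Rightarrow> bool" where
  "minimal_system G act \<longleftrightarrow>
     (\<forall>C. closed C \<and> (\<forall>g\<in>carrier G. (\<lambda>x. act x g) ` C = C) \<longrightarrow> C = {} \<or> C = UNIV)"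

text \<open>A Cantor set is a homeomorphic copy of \<open>{0,1}\<^sup>\<nat>\<close> with the product topology.\<close>

definition cantor_system :: "('x::metric_space \<Rightarrow> 'g \<Rightarrow> 'x) \<Rightarrow> bool" where
  "cantor_system act \<longleftrightarrow> (UNIV :: 'x set) homeomorphic (UNIV :: (nat \<Rightarrow> bool) set)"

definition extension_of ::
    "('g, 'm) monoid_scheme \<Rightarrow> ('x::metric_space \<Rightarrow> 'g \<Rightarrow> 'x) \<Rightarrow>
     ('y::metric_space \<Rightarrow> 'g \<Rightarrow> 'y) \<Rightarrow> bool" where
  "extension_of G act act' \<longleftrightarrow>
     (\<exists>\<pi>. continuous_on UNIV \<pi> \<and> surj \<pi> \<and>
          (\<forall>x. \<forall>g\<in>carrier G. \<pi> (act x g) = act' (\<pi> x) g))"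

definition invariant_prob ::
    "('g, 'm) monoid_scheme \<Rightarrow> ('x::metric_space \<Rightarrow> 'g \<Rightarrow> 'x) \<Rightarrow> 'x measure \<Rightarrow> bool" where
  "invariant_prob G act \<mu> \<longleftrightarrow>
     prob_space \<mu> \<and> sets \<mu> = sets borel \<and>
     (\<forall>g\<in>carrier G. distr \<mu> borel (\<lambda>x. act x g) = \<mu>)"

definition small_boundary_property ::
    "('g, 'm) monoid_scheme \<Rightarrow> ('x::metric_space \<Rightarrow> 'g \<Rightarrow> 'x) \<Rightarrow> bool" where
  "small_boundary_property G act \<longleftrightarrow>
     (\<exists>\<B>. topological_basis \<B> \<and>
          (\<forall>U\<in>\<B>. \<forall>\<mu>. invariant_prob G act \<mu> \<longrightarrow> measure \<mu> (frontier U) = 0))"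

text \<open>The orbit capacity is the common value of the limits along all Folner sequences.\<close>

definition ocap ::
    "('g, 'm) monoid_scheme \<Rightarrow> ('x::metric_space \<Rightarrow> 'g \<Rightarrow> 'x) \<Rightarrow> 'x set \<Rightarrow> real" where
  "ocap G act E =
     (THE c. \<forall>F. folner_sequence G F \<longrightarrow>
        (\<lambda>n. 1 / real (card (F n)) * (SUP x. \<Sum>g\<in>F n. indicator E (act x g))) \<longlonglongrightarrow> c)"

definition URP ::
    "('g, 'm) monoid_scheme \<Rightarrow> ('x::metric_space \<Rightarrow> 'g \<Rightarrow> 'x) \<Rightarrow> bool" where
  "URP G act \<longleftrightarrow>
     (\<forall>\<epsilon> K. \<epsilon> > 0 \<and> finite K \<and> K \<noteq> {} \<and> K \<subseteq> carrier G \<longrightarrow>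
        (\<exists>(S::nat) (B :: nat \<Rightarrow> 'x set) (F :: nat \<Rightarrow> 'g set).
           (\<forall>s\<in>{1..S}. closed (B s) \<and> KE_invariant G K \<epsilon> (F s)) \<and>
           disjoint_family_on (\<lambda>(s, g). (\<lambda>x. act x g) ` B s) (SIGMA s:{1..S}. F s) \<and>
           ocap G act (UNIV - (\<Union>s\<in>{1..S}. \<Union>g\<in>F s. (\<lambda>x. act x g) ` B s)) < \<epsilon>))"

end

theory Submission
  imports Defs
begin

text \<open>
  Both hypotheses enter only through the factor \<open>Y\<close>: a tower decomposition of \<open>Y\<close> pulls back to
  \<open>X\<close>, and a Cantor system has a basis of clopen sets, whose boundaries are empty.

  All densities are measured by invariant means, that is, invariant finitely additive probabilities
  on all subsets. By Tychonoff compactness the orbit capacity of \<open>E\<close> is the supremum of \<open>m E\<close> over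
  the invariant means \<open>m\<close>, so the counting in the Ornstein--Weiss quasi-tiling argument becomes
  exact: a new shape \<open>F\<close> is placed greedily, trimmed by what is covered already, until every window
  \<open>y F\<close> is covered in proportion \<open>\<epsilon>\<close>; since the old shapes are nearly \<open>F\<^sup>-\<^sup>1\<close>-invariant, this shrinks
  the mean of the uncovered part by a factor close to \<open>1 - \<epsilon>\<close>.

  The bases of the towers are Boolean combinations of translates of sets from the small boundary
  basis. Every invariant mean is dominated on closed sets by an invariant Borel probability measure,
  so null boundaries have neighbourhoods that are small for all invariant means simultaneously, and
  the bases can be replaced by closed subsets.
\<close>

section \<open>Invariant means and orbit capacity\<close>

locale finadd_prob =
  fixes m :: "'a set \<Rightarrow> real"
  assumes nonneg: "0 \<le> m A"
    and total: "m UNIV = 1"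
    and additive: "A \<inter> B = {} \<Longrightarrow> m (A \<union> B) = m A + m B"
begin

lemma empty [simp]: "m {} = 0"
  using additive[of "{}" "{}"] by simp

lemma diff: "A \<subseteq> B \<Longrightarrow> m (B - A) = m B - m A"
  using additive[of A "B - A"] by (simp add: Un_absorb1)

lemma mono: "A \<subseteq> B \<Longrightarrow> m A \<le> m B"
  using diff[of A B] nonneg[of "B - A"] by simp

lemma compl: "m (- A) = 1 - m A"
  using diff[of A UNIV] total by (simp add: Compl_eq_Diff_UNIV)

lemma le_1: "m A \<le> 1"
  using mono[of A UNIV] total by simp

lemma finite_additive:
  "finite I \<Longrightarrow> disjoint_family_on E I \<Longrightarrow> m (\<Union>i\<in>I. E i) = (\<Sum>i\<in>I. m (E i))"
proof (induction I rule: finite_induct)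
  case (insert i I)
  then have "E i \<inter> (\<Union>j\<in>I. E j) = {}"
    by (auto simp: disjoint_family_on_def)
  with insert show ?case
    by (simp add: additive disjoint_family_on_def)
qed simp

text \<open>The simple function is constant on every atom \<open>P J\<close> of the finite algebra
  generated by the \<open>E i\<close>, so its integral against \<open>m\<close> is a combination of
  masses of atoms. Finite additivity is thus enough for monotone integration.\<close>

lemma sum_nonneg_of_indicator:
  assumes fin: "finite I" and pos: "\<And>y. 0 \<le> (\<Sum>i\<in>I. a i * indicator (E i) y)"
  shows "0 \<le> (\<Sum>i\<in>I. a i * m (E i))"
proof -
  define P where "P J = {y. {i\<in>I. y \<in> E i} = J}" for J
  have disj: "disjoint_family_on P X" for X
    by (auto simp: disjoint_family_on_def P_def)
  have E: "m (E i) = (\<Sum>J\<in>Pow I. if i \<in> J then m (P J) else 0)" if "i \<in> I" for i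
  proof -
    have "E i = (\<Union>J\<in>{J\<in>Pow I. i \<in> J}. P J)"
      using that by (auto simp: P_def)
    then have "m (E i) = (\<Sum>J\<in>{J\<in>Pow I. i \<in> J}. m (P J))"
      using fin disj by (simp add: finite_additive)
    then show ?thesis
      using fin by (simp add: sum.If_cases Int_def)
  qed
  have "(\<Sum>i\<in>I. a i * m (E i)) = (\<Sum>i\<in>I. \<Sum>J\<in>Pow I. if i \<in> J then a i * m (P J) else 0)"
    by (intro sum.cong refl) (simp add: E sum_distrib_left if_distrib cong: if_cong)
  also have "\<dots> = (\<Sum>J\<in>Pow I. \<Sum>i\<in>I. if i \<in> J then a i * m (P J) else 0)"
    by (rule sum.swap)
  also have "\<dots> \<ge> 0"
  proof (rule sum_nonneg)
    fix J assume J: "J \<in> Pow I"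
    have eq: "(\<Sum>i\<in>I. if i \<in> J then a i * m (P J) else 0) = (\<Sum>i\<in>J. a i) * m (P J)"
      using fin J by (simp add: sum.If_cases sum_distrib_right Int_absorb1)
    show "0 \<le> (\<Sum>i\<in>I. if i \<in> J then a i * m (P J) else 0)"
    \<comment> \<open>Nothing is known about the sum over \<open>J\<close> when no point realises
      the pattern \<open>J\<close>; the atom then has mass 0.\<close>
    proof (cases "P J = {}")
      case False
      then obtain y where y: "{i\<in>I. y \<in> E i} = J" by (auto simp: P_def)
      have "(\<Sum>i\<in>I. a i * indicator (E i) y) = (\<Sum>i\<in>J. a i)"
        using fin by (simp add: y[symmetric] indicator_def sum.If_cases if_distrib Int_def cong: if_cong)
      with pos[of y] have "0 \<le> (\<Sum>i\<in>J. a i)" by simp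
      then show ?thesis by (simp add: eq nonneg)
    qed (simp add: eq)
  qed
  finally show ?thesis .
qed

text \<open>Moving the left side over with negated coefficients, indexed by the disjoint sum
  \<open>I <+> J\<close>, reduces this to nonnegativity. The double countings in
  \<open>mean_le_average\<close> and \<open>cover_gain\<close> are instances.\<close>

lemma sum_le_of_indicator:
  assumes fin: "finite I" "finite J"
    and le: "\<And>y. (\<Sum>i\<in>I. a i * indicator (E i) y) \<le> (\<Sum>j\<in>J. b j * indicator (D j) y)"
  shows "(\<Sum>i\<in>I. a i * m (E i)) \<le> (\<Sum>j\<in>J. b j * m (D j))"
proof -
  let ?a = "case_sum (\<lambda>i. - a i) b" and ?E = "case_sum E D"
  have "0 \<le> (\<Sum>k\<in>I <+> J. ?a k * m (?E k))"
    using fin le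
    by (intro sum_nonneg_of_indicator)
      (simp_all add: sum.Plus sum_negf del: sum_mult_indicator sum_indicator_mult)
  then show ?thesis
    using fin by (simp add: sum.Plus sum_negf)
qed

lemma UN_le: "finite I \<Longrightarrow> m (\<Union>i\<in>I. E i) \<le> (\<Sum>i\<in>I. m (E i))"
proof (induction I rule: finite_induct)
  case (insert i I)
  have "m (E i \<union> (\<Union>j\<in>I. E j)) = m (E i) + m ((\<Union>j\<in>I. E j) - E i)"
    using additive[of "E i" "(\<Union>j\<in>I. E j) - E i"] by simp
  also have "\<dots> \<le> m (E i) + m (\<Union>j\<in>I. E j)"
    by (simp add: mono)
  finally show ?case using insert by simp
qed simp

lemma Un_le: "m (A \<union> B) \<le> m A + m B"
  using additive[of A "B - A"] mono[of "B - A" B] by simp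

end

lemma finadd_prob_average:
  assumes "finite F" "F \<noteq> {}"
  shows "finadd_prob (\<lambda>A. (\<Sum>g\<in>F. indicator A (x g)) / real (card F))"
proof
  fix A B :: "'b set" assume "A \<inter> B = {}"
  then have "indicator (A \<union> B) y = (indicator A y + indicator B y :: real)" for y
    by (auto simp: indicator_def)
  then show "(\<Sum>g\<in>F. indicator (A \<union> B) (x g)) / real (card F) =
      (\<Sum>g\<in>F. indicator A (x g)) / real (card F) + (\<Sum>g\<in>F. indicator B (x g)) / real (card F)"
    by (simp add: sum.distrib add_divide_distrib)
qed (use assms in \<open>auto intro!: divide_nonneg_nonneg sum_nonneg\<close>)

section \<open>Compactness of the set of invariant means\<close>

definition invariant_mean ::
    "('g, 'm) monoid_scheme \<Rightarrow> ('x \<Rightarrow> 'g \<Rightarrow> 'x) \<Rightarrow> ('x set \<Rightarrow> real) \<Rightarrow> bool" where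
  "invariant_mean G act m \<longleftrightarrow>
     finadd_prob m \<and> (\<forall>g\<in>carrier G. \<forall>A. m ((\<lambda>x. act x g) -` A) = m A)"

text \<open>Set functions carry the product topology, so evaluating at a set is a coordinate
  projection. Weak inequalities and equations between finitely many values are therefore closed
  conditions.\<close>

lemma continuous_eval: "continuous_on UNIV (\<lambda>p :: 'a set \<Rightarrow> real. p A)"
  by (rule continuous_on_product_coordinates)

lemma closed_finadd_prob: "closed {m :: 'a set \<Rightarrow> real. finadd_prob m}"
proof -
  have "{m :: 'a set \<Rightarrow> real. finadd_prob m} = (\<Inter>A. {m. 0 \<le> m A}) \<inter> {m. m UNIV = 1} \<inter>
      (\<Inter>A. \<Inter>B\<in>{B. A \<inter> B = {}}. {m. m (A \<union> B) = m A + m B})"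
    by (auto simp: finadd_prob_def)
  also have "closed \<dots>"
    by (intro closed_Int closed_INT ballI closed_Collect_le closed_Collect_eq
        continuous_intros continuous_eval)
  finally show ?thesis .
qed

lemma closed_invariant_mean: "closed {m. invariant_mean G act m}"
proof -
  have "{m. invariant_mean G act m} = {m. finadd_prob m} \<inter>
      (\<Inter>g\<in>carrier G. \<Inter>A. {m. m ((\<lambda>x. act x g) -` A) = m A})"
    by (auto simp: invariant_mean_def)
  also have "closed \<dots>"
    by (intro closed_Int closed_INT ballI closed_Collect_eq closed_finadd_prob continuous_eval)
  finally show ?thesis .
qed

lemma compact_unit_functions: "compact {p :: 'a \<Rightarrow> real. \<forall>A. p A \<in> {0..1}}"
proof -
  have "compactin (product_topology (\<lambda>_. euclidean) UNIV) (\<Pi>\<^sub>E A\<in>(UNIV :: 'a set). {0..1 :: real})"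
    by (simp add: compactin_PiE)
  then show ?thesis
    by (simp add: euclidean_product_topology PiE_UNIV_domain Pi_def)
qed

text \<open>The product over all sets is in general not metrizable, so a sequence need not have a
  convergent subsequence; a cluster point along a filter takes its place. Later uses only need that
  closed conditions holding eventually pass to it.\<close>

lemma finadd_prob_cluster_point:
  fixes p :: "nat \<Rightarrow> 'a set \<Rightarrow> real"
  assumes F: "F \<noteq> bot" and p: "\<forall>\<^sub>F n in F. finadd_prob (p n)"
  obtains m where "finadd_prob m" "\<And>S. closed S \<Longrightarrow> \<forall>\<^sub>F n in F. p n \<in> S \<Longrightarrow> m \<in> S"
proof -
  let ?F = "filtermap p F"
  have "?F \<noteq> bot" using F by (simp add: filtermap_bot_iff)
  moreover have "eventually (\<lambda>q. q \<in> {p. \<forall>A. p A \<in> {0..1}}) ?F"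
    unfolding eventually_filtermap using p
    by eventually_elim (auto simp: finadd_prob.nonneg finadd_prob.le_1)
  ultimately obtain m where m: "inf (nhds m) ?F \<noteq> bot"
    using compact_unit_functions[unfolded compact_filter] by blast
  have cl: "m \<in> S" if S: "closed S" "\<forall>\<^sub>F n in F. p n \<in> S" for S
  proof (rule ccontr)
    assume "m \<notin> S"
    then have "eventually (\<lambda>q. q \<in> - S) (nhds m)"
      using S(1) by (intro eventually_nhds_in_open) auto
    moreover have "eventually (\<lambda>q. q \<in> S) ?F"
      using S(2) by (simp add: eventually_filtermap)
    ultimately have "eventually (\<lambda>q. False) (inf (nhds m) ?F)"
      unfolding eventually_inf by (intro exI[of _ "\<lambda>q. q \<in> - S"] exI[of _ "\<lambda>q. q \<in> S"]) auto
    with m show False by simp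
  qed
  moreover have "finadd_prob m"
    using cl[OF closed_finadd_prob] p by simp
  ultimately show thesis using that by blast
qed

lemma sum_indicator_card: "finite F \<Longrightarrow> (\<Sum>g\<in>F. indicator A (f g)) = real (card {g\<in>F. f g \<in> A})"
  by (simp add: indicator_def sum.If_cases Int_def)

lemma bdd_above_sum_indicator:
  "finite F \<Longrightarrow> bdd_above (range (\<lambda>x. \<Sum>g\<in>F. indicator E (f x g) :: real))"
  by (intro bdd_aboveI[of _ "real (card F)"]) (auto simp: sum_indicator_card card_mono)

text \<open>The counts are natural numbers at most \<open>card F\<close>, so only finitely many
  values occur. A point realising the supremum starts the averages in
  \<open>exists_mean_ge\<close>.\<close>

lemma SUP_sum_indicator_attained:
  assumes "finite F"
  obtains x where "(SUP x. \<Sum>g\<in>F. indicator E (f x g) :: real) = (\<Sum>g\<in>F. indicator E (f x g))"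
proof -
  let ?r = "\<lambda>x. \<Sum>g\<in>F. indicator E (f x g) :: real"
  have "range ?r \<subseteq> real ` {..card F}"
    using assms by (auto simp: sum_indicator_card card_mono)
  then have fin: "finite (range ?r)" by (rule finite_subset) simp
  then have "Sup (range ?r) \<in> range ?r"
    by (simp add: cSup_eq_Max Max_in)
  then show thesis using that by auto
qed

section \<open>Orbit capacity as a supremum over invariant means\<close>

locale dynamics = group G for G :: "('g, 'm) monoid_scheme" (structure) +
  fixes act :: "'x::metric_space \<Rightarrow> 'g \<Rightarrow> 'x"
  assumes dyn: "dyn_system G act"
begin

lemma act_one [simp]: "act x \<one> = x"
  using dyn by (simp add: dyn_system_def)

lemma act_mult: "g \<in> carrier G \<Longrightarrow> h \<in> carrier G \<Longrightarrow> act (act x g) h = act x (g \<otimes> h)"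
  using dyn by (simp add: dyn_system_def)

lemma act_inv [simp]:
  "g \<in> carrier G \<Longrightarrow> act (act x g) (inv g) = x"
  "g \<in> carrier G \<Longrightarrow> act (act x (inv g)) g = x"
  by (simp_all add: act_mult)

lemma act_inj: "g \<in> carrier G \<Longrightarrow> act x g = act y g \<longleftrightarrow> x = y"
  by (metis act_inv(1))

lemma act_image: "g \<in> carrier G \<Longrightarrow> (\<lambda>x. act x g) ` A = (\<lambda>x. act x (inv g)) -` A"
  by (auto simp: image_iff) (metis act_inv(2))

lemma continuous_act: "g \<in> carrier G \<Longrightarrow> continuous_on A (\<lambda>x. act x g)"
  using dyn unfolding dyn_system_def
  by (meson continuous_on_subset homeomorphism_cont1 subset_UNIV)

lemma homeomorphism_act:
  "g \<in> carrier G \<Longrightarrow> homeomorphism UNIV UNIV (\<lambda>x. act x g) (\<lambda>x. act x (inv g))"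
  by (auto simp: homeomorphism_def continuous_act image_iff) (metis act_inv)+

lemma compact_space: "compact (UNIV :: 'x set)"
  using dyn by (simp add: dyn_system_def)

abbreviation "mean \<equiv> invariant_mean G act"

lemma mean_finadd: "mean m \<Longrightarrow> finadd_prob m"
  by (simp add: invariant_mean_def)

lemma mean_vimage: "mean m \<Longrightarrow> g \<in> carrier G \<Longrightarrow> m ((\<lambda>x. act x g) -` A) = m A"
  by (simp add: invariant_mean_def)

lemma mean_image: "mean m \<Longrightarrow> g \<in> carrier G \<Longrightarrow> m ((\<lambda>x. act x g) ` A) = m A"
  by (simp add: act_image mean_vimage)

text \<open>The visits to \<open>E\<close> in the window \<open>F\<close> are at most the supremum
  at every point; integrating against \<open>m\<close> gives the claim, since by invariance each
  position contributes \<open>m E\<close>. No limit is involved.\<close>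

lemma mean_le_average:
  assumes m: "mean m" and F: "finite F" "F \<noteq> {}" "F \<subseteq> carrier G"
  shows "m E \<le> 1 / real (card F) * (SUP x. \<Sum>g\<in>F. indicator E (act x g))"
proof -
  interpret finadd_prob m using m by (rule mean_finadd)
  let ?s = "SUP x. \<Sum>g\<in>F. indicator E (act x g) :: real"
  \<comment> \<open>A sum over the one-point set \<open>{()}\<close> puts a constant into the form
    that \<open>sum_le_of_indicator\<close> expects.\<close>
  have "(\<Sum>g\<in>F. 1 * m ((\<lambda>x. act x g) -` E)) \<le> (\<Sum>j\<in>{()}. ?s * m UNIV)"
  proof (rule sum_le_of_indicator)
    fix y
    have "(\<Sum>g\<in>F. indicator E (act y g)) \<le> ?s"
      using F by (intro cSUP_upper bdd_above_sum_indicator) auto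
    then show "(\<Sum>g\<in>F. 1 * indicator ((\<lambda>x. act x g) -` E) y) \<le> (\<Sum>j\<in>{()}. ?s * indicator UNIV y)"
      by (simp add: indicator_vimage)
  qed (use F in auto)
  moreover have "(\<Sum>g\<in>F. 1 * m ((\<lambda>x. act x g) -` E)) = card F * m E"
    using F by (simp add: mean_vimage[OF m] subset_eq)
  ultimately show ?thesis
    using F by (simp add: total field_simps card_gt_0_iff)
qed

text \<open>Reindexing by right multiplication turns the first sum into a sum over
  \<open>F <#> {g}\<close>; the two sums then differ only on the symmetric difference, where each
  term is at most 1.\<close>

lemma average_shift:
  assumes F: "finite F" "F \<subseteq> carrier G" and g: "g \<in> carrier G"
  shows "\<bar>(\<Sum>h\<in>F. indicator ((\<lambda>x. act x g) -` A) (act y h)) - (\<Sum>h\<in>F. indicator A (act y h))\<bar>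
    \<le> real (card (sym_diff (F <#> {g}) F))"
proof -
  have Fg: "F <#> {g} = (\<lambda>h. h \<otimes> g) ` F"
    by (auto simp: set_mult_def)
  have inj: "inj_on (\<lambda>h. h \<otimes> g) F"
    using F g by (intro inj_onI) (meson right_cancel subsetD)
  have fin: "finite (F <#> {g})" using F by (simp add: Fg)
  let ?i = "\<lambda>h. indicator A (act y h) :: real"
  have "(\<Sum>h\<in>F. indicator ((\<lambda>x. act x g) -` A) (act y h)) = (\<Sum>h\<in>F. ?i (h \<otimes> g))"
    using F g by (intro sum.cong) (auto simp: indicator_def act_mult)
  also have "\<dots> = sum ?i (F <#> {g})"
    by (simp add: Fg sum.reindex[OF inj])
  finally have 1: "(\<Sum>h\<in>F. indicator ((\<lambda>x. act x g) -` A) (act y h)) = sum ?i (F <#> {g})" .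
  have "sum ?i (F <#> {g}) - sum ?i F = sum ?i ((F <#> {g}) - F) - sum ?i (F - (F <#> {g}))"
    using fin F(1) by (simp add: sum_diff1' sum.Int_Diff[of "F <#> {g}" ?i F]
        sum.Int_Diff[of F ?i "F <#> {g}"] Int_commute)
  also have "\<bar>\<dots>\<bar> \<le> sum ?i ((F <#> {g}) - F) + sum ?i (F - (F <#> {g}))"
    using sum_nonneg[of "(F <#> {g}) - F" ?i] sum_nonneg[of "F - (F <#> {g})" ?i] by simp
  also have "\<dots> = sum ?i (sym_diff (F <#> {g}) F)"
    using fin F(1) by (subst sum.union_disjoint) auto
  also have "\<dots> \<le> (\<Sum>h\<in>sym_diff (F <#> {g}) F. 1)"
    by (intro sum_mono) (auto simp: indicator_def)
  finally show ?thesis by (simp add: 1)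
qed

text \<open>Krylov-Bogoliubov construction: average along the orbit pieces that realise the supremum
  and take a cluster point. The Folner property makes it invariant, and the lower bound survives
  because it holds along the chosen filter.\<close>

lemma exists_mean_ge:
  assumes fol: "folner_sequence G F"
    and freq: "\<exists>\<^sub>F n in sequentially. a \<le> 1 / real (card (F n)) * (SUP x. \<Sum>g\<in>F n. indicator E (act x g))"
  shows "\<exists>m. mean m \<and> a \<le> m E"
proof -
  have Ffin: "finite (F n)" and Fsub: "F n \<subseteq> carrier G" for n
    using fol by (auto simp: folner_sequence_def)
  have KE: "\<forall>\<^sub>F n in sequentially. KE_invariant G {g} \<eta> (F n)" if "g \<in> carrier G" "\<eta> > 0" for g \<eta>
    using fol that by (auto simp: folner_sequence_def)
  have "\<exists>x. (SUP x. \<Sum>g\<in>F n. indicator E (act x g) :: real) = (\<Sum>g\<in>F n. indicator E (act x g))" for n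
    using SUP_sum_indicator_attained[OF Ffin] by metis
  then obtain y where y: "\<And>n. (SUP x. \<Sum>g\<in>F n. indicator E (act x g) :: real) =
      (\<Sum>g\<in>F n. indicator E (act (y n) g))"
    by metis
  define p where "p n A = (\<Sum>g\<in>F n. indicator A (act (y n) g)) / real (card (F n))" for n A
  define S where "S = {n. a \<le> p n E}"
  \<comment> \<open>Only indices satisfying the bound are kept; that they occur frequently is
    exactly what makes this filter proper.\<close>
  define Fl where "Fl = inf sequentially (principal S)"
  have "Fl \<noteq> bot"
    using freq by (simp add: Fl_def trivial_limit_def eventually_inf_principal S_def p_def y frequently_def)
  have le: "eventually P sequentially \<Longrightarrow> eventually P Fl" for P
    unfolding Fl_def by (auto simp: eventually_inf_principal elim: eventually_mono)
  have "\<forall>\<^sub>F n in Fl. finadd_prob (p n)"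
    \<comment> \<open>The pair of the unit and the constant 1 serves only to know that
      \<open>F n\<close> is eventually nonempty, so that the averages have total mass 1.\<close>
    using le[OF KE[OF one_closed zero_less_one]] unfolding p_def[abs_def]
    by eventually_elim (auto simp: KE_invariant_def intro: finadd_prob_average)
  then obtain m where m: "finadd_prob m" "\<And>S. closed S \<Longrightarrow> \<forall>\<^sub>F n in Fl. p n \<in> S \<Longrightarrow> m \<in> S"
    using finadd_prob_cluster_point[OF \<open>Fl \<noteq> bot\<close>] by blast
  have "m ((\<lambda>x. act x g) -` A) = m A" if g: "g \<in> carrier G" for g A
  proof -
    have "\<bar>m ((\<lambda>x. act x g) -` A) - m A\<bar> \<le> 0 + \<eta>" if "\<eta> > 0" for \<eta>
    proof -
      have "m \<in> {q. \<bar>q ((\<lambda>x. act x g) -` A) - q A\<bar> \<le> \<eta>}"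
      proof (rule m(2))
        show "closed {q. \<bar>q ((\<lambda>x. act x g) -` A) - q A\<bar> \<le> \<eta>}"
          by (intro closed_Collect_le continuous_intros continuous_eval)
        show "\<forall>\<^sub>F n in Fl. p n \<in> {q. \<bar>q ((\<lambda>x. act x g) -` A) - q A\<bar> \<le> \<eta>}"
          using le[OF KE[OF g \<open>\<eta> > 0\<close>]]
        proof eventually_elim
          case (elim n)
          have "\<bar>p n ((\<lambda>x. act x g) -` A) - p n A\<bar> =
            \<bar>(\<Sum>h\<in>F n. indicator ((\<lambda>x. act x g) -` A) (act (y n) h)) - (\<Sum>h\<in>F n. indicator A (act (y n) h))\<bar> / card (F n)"
            by (simp add: p_def flip: diff_divide_distrib)
          also have "\<dots> \<le> real (card (sym_diff (F n <#> {g}) (F n))) / card (F n)"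
            by (intro divide_right_mono average_shift g Ffin Fsub) simp
          also have "\<dots> \<le> \<eta>" using elim by (simp add: KE_invariant_def)
          finally show ?case by simp
        qed
      qed
      then show ?thesis by simp
    qed
    then have "\<bar>m ((\<lambda>x. act x g) -` A) - m A\<bar> \<le> 0" by (rule field_le_epsilon)
    then show ?thesis by simp
  qed
  moreover have "m \<in> {q. a \<le> q E}"
    by (rule m(2)) (auto intro!: closed_Collect_le continuous_intros continuous_eval
        simp: Fl_def S_def eventually_inf_principal)
  ultimately show ?thesis using m(1) by (auto simp: invariant_mean_def)
qed

text \<open>Along every Folner sequence the limit is \<open>s\<close>, the supremum of
  \<open>m E\<close> over all means. Each average over a nonempty window is at least
  \<open>s\<close> by \<open>mean_le_average\<close>; averages reaching some \<open>b > s\<close>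
  infinitely often would give, by \<open>exists_mean_ge\<close>, a mean exceeding the
  supremum.\<close>

lemma ocap_le:
  assumes fol: "folner_sequence G F0" and c: "\<And>m. mean m \<Longrightarrow> m E \<le> c"
  shows "ocap G act E \<le> c"
proof -
  define q where "q F = (1 / real (card F) * (SUP x. \<Sum>g\<in>F. indicator E (act x g)))" for F
  define s where "s = Sup {m E | m. mean m}"
  have q0: "0 \<le> q F" if fin: "finite F" for F
  proof -
    obtain x where "(SUP x. \<Sum>g\<in>F. indicator E (act x g) :: real) = (\<Sum>g\<in>F. indicator E (act x g))"
      by (rule SUP_sum_indicator_attained[OF fin])
    then show ?thesis by (simp add: q_def sum_nonneg)
  qed
  have ne: "{m E | m. mean m} \<noteq> {}"
  proof -
    \<comment> \<open>The bound 0 is trivial; the point is that some mean exists, so that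
      \<open>s\<close> is the supremum of a nonempty set.\<close>
    have "\<exists>m. mean m \<and> 0 \<le> m E"
    proof (rule exists_mean_ge[OF fol])
      show "\<exists>\<^sub>F n in sequentially. 0 \<le> 1 / real (card (F0 n)) * (SUP x. \<Sum>g\<in>F0 n. indicator E (act x g))"
        using fol q0 by (auto simp: folner_sequence_def q_def intro!: always_eventually eventually_frequently)
    qed
    then show ?thesis by blast
  qed
  have bdd: "bdd_above {m E | m. mean m}"
    using c by (intro bdd_aboveI[of _ c]) auto
  have lim: "(\<lambda>n. q (F n)) \<longlonglongrightarrow> s" if F: "folner_sequence G F" for F
  proof (rule order_tendstoI)
    fix b assume "b < s"
    have "\<forall>\<^sub>F n in sequentially. KE_invariant G {\<one>} 1 (F n)"
      using F by (simp add: folner_sequence_def)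
    then show "\<forall>\<^sub>F n in sequentially. b < q (F n)"
    proof eventually_elim
      case (elim n)
      have "s \<le> q (F n)"
        unfolding s_def q_def
        by (rule cSup_least[OF ne]) (use elim in \<open>auto simp: KE_invariant_def intro!: mean_le_average[simplified]\<close>)
      with \<open>b < s\<close> show ?case by simp
    qed
  next
    fix b assume "s < b"
    show "\<forall>\<^sub>F n in sequentially. q (F n) < b"
    proof (rule ccontr)
      assume "\<not> ?thesis"
      then have "\<exists>\<^sub>F n in sequentially. b \<le> q (F n)"
        by (simp add: frequently_def not_le)
      then obtain m where "mean m" "b \<le> m E"
        using exists_mean_ge[OF F] unfolding q_def by blast
      then have "b \<le> s" unfolding s_def using bdd by (intro cSup_upper2) auto
      with \<open>s < b\<close> show False by simp
    qed
  qed
  have "ocap G act E = s"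
    unfolding ocap_def q_def[symmetric]
  \<comment> \<open>Uniqueness needs at least one Folner sequence, supplied by \<open>fol\<close>;
    without any, every number would satisfy the condition vacuously.\<close>
  proof (rule the_equality)
    show "\<forall>F. folner_sequence G F \<longrightarrow> (\<lambda>n. q (F n)) \<longlonglongrightarrow> s" using lim by blast
    show "c' = s" if "\<forall>F. folner_sequence G F \<longrightarrow> (\<lambda>n. q (F n)) \<longlonglongrightarrow> c'" for c'
      using that fol lim LIMSEQ_unique by blast
  qed
  also have "s \<le> c" unfolding s_def using ne c by (intro cSup_least) auto
  finally show ?thesis .
qed

end

section \<open>Invariant measures dominating an invariant mean\<close>

text \<open>For open \<open>U\<close> these closed sets increase to \<open>U\<close> as
  \<open>e\<close> decreases to 0. For \<open>e \<le> 0\<close> the ball is empty and the erosion is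
  the whole space, hence the positivity conditions below.\<close>

definition erosion :: "real \<Rightarrow> 'a::metric_space set \<Rightarrow> 'a set" where
  "erosion e U = {x. ball x e \<subseteq> U}"

lemma erosion_subset: "0 < e \<Longrightarrow> erosion e U \<subseteq> U"
  by (auto simp: erosion_def)

lemma erosion_mono: "d \<le> e \<Longrightarrow> U \<subseteq> V \<Longrightarrow> erosion e U \<subseteq> erosion d V"
  by (force simp: erosion_def)

lemma closed_erosion: "closed (erosion e U)"
proof -
  have "erosion e U = (\<Inter>y\<in>- U. {x. e \<le> dist x y})"
    by (auto simp: erosion_def subset_iff not_less[symmetric])
  then show ?thesis
    by (auto intro!: closed_INT closed_Collect_le continuous_intros)
qed

text \<open>A Lebesgue number of a finite subcover is the common erosion radius.\<close>

lemma subset_erosion_cover: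
  fixes U :: "'i \<Rightarrow> 'a::metric_space set"
  assumes "compact K" "K \<subseteq> (\<Union>i\<in>I. U i)" "\<And>i. i \<in> I \<Longrightarrow> open (U i)"
  obtains e J where "0 < e" "finite J" "J \<subseteq> I" "K \<subseteq> (\<Union>i\<in>J. erosion e (U i))"
proof -
  obtain J where J: "J \<subseteq> I" "finite J" "K \<subseteq> (\<Union>i\<in>J. U i)"
    using compactE_image[OF assms(1), of I U] assms(2,3) by metis
  obtain e where e: "0 < e" "\<And>x. x \<in> K \<Longrightarrow> \<exists>V\<in>U ` J. ball x e \<subseteq> V"
    using Heine_Borel_lemma[OF assms(1) J(3)] assms(3) J(1) by (metis imageE subsetD)
  have "K \<subseteq> (\<Union>i\<in>J. erosion e (U i))"
    using e(2) by (fastforce simp: erosion_def)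
  with e(1) J(1,2) show thesis using that by blast
qed

text \<open>
  A finitely additive \<open>m\<close> need not be continuous along increasing unions, so an open set is weighed
  by exhausting it with erosions instead of by \<open>m\<close> itself.
\<close>

definition open_weight :: "('a::metric_space set \<Rightarrow> real) \<Rightarrow> 'a set \<Rightarrow> ennreal" where
  "open_weight m U = (SUP e\<in>{0<..}. ennreal (m (erosion e U)))"

text \<open>The outer regular extension that is applied to contents in the Riesz representation
  theorem.\<close>

definition regular_outer :: "('a::metric_space set \<Rightarrow> real) \<Rightarrow> 'a set \<Rightarrow> ennreal" where
  "regular_outer m A = (INF U\<in>{U. open U \<and> A \<subseteq> U}. open_weight m U)"

lemma erosion_le_open_weight: "0 < e \<Longrightarrow> ennreal (m (erosion e U)) \<le> open_weight m U"
  unfolding open_weight_def by (intro SUP_upper) auto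

lemma regular_outer_le: "open U \<Longrightarrow> A \<subseteq> U \<Longrightarrow> regular_outer m A \<le> open_weight m U"
  unfolding regular_outer_def by (intro INF_lower) auto

lemma regular_outer_mono: "A \<subseteq> B \<Longrightarrow> regular_outer m A \<le> regular_outer m B"
  unfolding regular_outer_def by (intro INF_superset_mono) auto

section \<open>Extension to a Borel measure by Caratheodory's method\<close>

locale compact_finadd_prob = finadd_prob m for m :: "'a::metric_space set \<Rightarrow> real" +
  assumes compact_space: "compact (UNIV :: 'a set)"
begin

abbreviation "wt \<equiv> open_weight m"
abbreviation "outer \<equiv> regular_outer m"

lemma compact_erosion: "compact (erosion e (U :: 'a set))"
  using closed_Int_compact[OF closed_erosion compact_space, of e U] by simp

lemma open_weight_mono:
  assumes "U \<subseteq> V"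
  shows "wt U \<le> wt V"
  unfolding open_weight_def
proof (rule SUP_mono)
  fix e :: real assume "e \<in> {0<..}"
  then show "\<exists>d\<in>{0<..}. ennreal (m (erosion e U)) \<le> ennreal (m (erosion d V))"
    using assms by (intro bexI[of _ e] ennreal_leI mono erosion_mono) auto
qed

text \<open>Erosions are compact, so finitely many erosions of the \<open>U i\<close> already cover
  a given erosion of the union. Compactness replaces the countable additivity that \<open>m\<close>
  lacks.\<close>

lemma open_weight_UN:
  fixes U :: "nat \<Rightarrow> 'a set"
  assumes "\<And>i. open (U i)"
  shows "wt (\<Union>i. U i) \<le> (\<Sum>i. wt (U i))"
  unfolding open_weight_def[of m "\<Union>i. U i"]
proof (rule SUP_least)
  fix e :: real assume "e \<in> {0<..}"
  then have "erosion e (\<Union>i. U i) \<subseteq> (\<Union>i. U i)" by (intro erosion_subset) auto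
  then obtain d J where d: "0 < d" "finite J" "erosion e (\<Union>i. U i) \<subseteq> (\<Union>i\<in>J. erosion d (U i))"
    using subset_erosion_cover[OF compact_erosion, of e "\<Union>i. U i" U UNIV] assms by metis
  have "m (erosion e (\<Union>i. U i)) \<le> (\<Sum>i\<in>J. m (erosion d (U i)))"
    using mono[OF d(3)] UN_le[OF d(2), of "\<lambda>i. erosion d (U i)"] by simp
  then have "ennreal (m (erosion e (\<Union>i. U i))) \<le> (\<Sum>i\<in>J. ennreal (m (erosion d (U i))))"
    by (subst sum_ennreal) (auto intro: ennreal_leI nonneg)
  also have "\<dots> \<le> (\<Sum>i\<in>J. wt (U i))"
    by (intro sum_mono erosion_le_open_weight d(1))
  also have "\<dots> \<le> (\<Sum>i. wt (U i))"
    by (intro sum_le_suminf d(2)) auto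
  finally show "ennreal (m (erosion e (\<Union>i. U i))) \<le> (\<Sum>i. wt (U i))" .
qed

lemma regular_outer_open: "open U \<Longrightarrow> outer U = wt U"
  by (intro antisym regular_outer_le order_refl)
    (auto simp: regular_outer_def intro!: INF_greatest open_weight_mono)

lemma outer_measure_space_regular_outer: "outer_measure_space UNIV outer"
  unfolding outer_measure_space_def
proof (intro conjI)
  have "wt {} = 0"
    by (auto simp: open_weight_def erosion_def simp flip: bot_ennreal)
  then show "positive UNIV outer"
    by (simp add: positive_def regular_outer_open)
  show "increasing UNIV outer"
    by (simp add: increasing_def regular_outer_mono)
  show "countably_subadditive UNIV outer"
    unfolding countably_subadditive_def
  proof (intro allI impI)
    fix A :: "nat \<Rightarrow> 'a set"
    show "outer (\<Union>i. A i) \<le> (\<Sum>i. outer (A i))"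
    proof (rule ennreal_le_epsilon)
      fix e :: real assume e: "0 < e" "(\<Sum>i. outer (A i)) < top_class.top"
      then have "outer (A i) < outer (A i) + e * (1/2)^Suc i" for i
        by (auto simp add: less_top dest!: ennreal_suminf_lessD)
      then have "\<exists>U. open U \<and> A i \<subseteq> U \<and> wt U < outer (A i) + e * (1/2)^Suc i" for i
        by (subst (asm) (1) regular_outer_def) (auto simp: INF_less_iff)
      then obtain U where U: "\<And>i. open (U i)" "\<And>i. A i \<subseteq> U i"
        "\<And>i. wt (U i) < outer (A i) + e * (1/2)^Suc i" by metis
      have "outer (\<Union>i. A i) \<le> wt (\<Union>i. U i)"
        using U(1,2) by (intro regular_outer_le) auto
      also have "\<dots> \<le> (\<Sum>i. wt (U i))" by (rule open_weight_UN[OF U(1)])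
      also have "\<dots> \<le> (\<Sum>i. outer (A i) + e * (1/2)^Suc i)"
        by (intro suminf_le less_imp_le U) auto
      also have "\<dots> = (\<Sum>i. outer (A i)) + (\<Sum>i. ennreal e * ennreal ((1/2) ^ Suc i))"
        using e(1) by (subst suminf_add[symmetric])
          (auto simp del: ennreal_suminf_cmult simp add: ennreal_mult[symmetric])
      also have "\<dots> = (\<Sum>i. outer (A i)) + e"
        unfolding ennreal_suminf_cmult
        by (subst suminf_ennreal_eq[OF zero_le_power power_half_series]) auto
      finally show "outer (\<Union>i. A i) \<le> (\<Sum>i. outer (A i)) + ennreal e" .
    qed
  qed
qed

text \<open>Caratheodory's inequality for open test sets. Cutting the closed set
  \<open>erosion e (U \<inter> V)\<close> out of \<open>U\<close> leaves an open set that contains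
  \<open>U - V\<close>; its erosions are disjoint from the set cut out, so finite additivity of
  \<open>m\<close> applies. Suprema over both radii finish.\<close>

lemma open_weight_split:
  assumes "open U" "open V"
  shows "outer (U \<inter> V) + outer (U - V) \<le> wt U"
proof -
  have "ennreal (m (erosion e (U \<inter> V))) + outer (U - V) \<le> wt U" if e: "0 < e" for e
  proof -
    let ?W = "U - erosion e (U \<inter> V)"
    have W: "open ?W" using assms(1) closed_erosion by blast
    have "U - V \<subseteq> ?W" using erosion_subset[OF e, of "U \<inter> V"] by auto
    then have "outer (U - V) \<le> wt ?W" by (rule regular_outer_le[OF W])
    then have "ennreal (m (erosion e (U \<inter> V))) + outer (U - V) \<le>
        ennreal (m (erosion e (U \<inter> V))) + wt ?W" by (rule add_left_mono)
    also have "\<dots> = (SUP d\<in>{0<..}. ennreal (m (erosion e (U \<inter> V))) + ennreal (m (erosion d ?W)))"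
      unfolding open_weight_def[of m ?W] by (subst ennreal_SUP_add_right) auto
    also have "\<dots> \<le> wt U"
    proof (rule SUP_least)
      fix d :: real assume "d \<in> {0<..}"
      then have d: "0 < d" by simp
      have "erosion d ?W \<subseteq> ?W" by (rule erosion_subset[OF d])
      then have "m (erosion e (U \<inter> V) \<union> erosion d ?W) = m (erosion e (U \<inter> V)) + m (erosion d ?W)"
        by (intro additive) auto
      moreover have "m (erosion e (U \<inter> V) \<union> erosion d ?W) \<le> m (erosion (min d e) U)"
        using erosion_mono[of "min d e" e "U \<inter> V" U] erosion_mono[of "min d e" d ?W U]
        by (intro mono) auto
      ultimately have "ennreal (m (erosion e (U \<inter> V)) + m (erosion d ?W)) \<le> ennreal (m (erosion (min d e) U))"
        by (simp add: ennreal_leI)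
      also have "\<dots> \<le> wt U" using d e by (intro erosion_le_open_weight) simp
      finally show "ennreal (m (erosion e (U \<inter> V))) + ennreal (m (erosion d ?W)) \<le> wt U"
        by (simp add: nonneg)
    qed
    finally show ?thesis .
  qed
  then have "(SUP e\<in>{0<..}. ennreal (m (erosion e (U \<inter> V))) + outer (U - V)) \<le> wt U"
    by (intro SUP_least) auto
  then show ?thesis
    using assms by (simp add: regular_outer_open open_Int open_weight_def[of m "U \<inter> V"] ennreal_SUP_add_left)
qed

lemma open_in_lambda_system:
  assumes V: "open V"
  shows "V \<in> lambda_system UNIV UNIV outer"
proof -
  interpret S: sigma_algebra UNIV "UNIV :: 'a set set"
    using sigma_algebra_Pow[of UNIV] by simp
  have "subadditive UNIV outer"
    using outer_measure_space_regular_outer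
    by (intro S.countably_subadditive_subadditive) (auto simp: outer_measure_space_def)
  then have sub: "outer (A \<union> B) \<le> outer A + outer B" if "A \<inter> B = {}" for A B
    using that by (auto simp: subadditive_def)
  have "outer (A \<inter> V) + outer (A - V) = outer A" for A
  proof (rule antisym)
    show "outer (A \<inter> V) + outer (A - V) \<le> outer A"
      unfolding regular_outer_def[of m A]
    proof (rule INF_greatest)
      fix U assume "U \<in> {U. open U \<and> A \<subseteq> U}"
      then have U: "open U" "A \<subseteq> U" by auto
      have "outer (A \<inter> V) + outer (A - V) \<le> outer (U \<inter> V) + outer (U - V)"
        using U by (intro add_mono regular_outer_mono) auto
      also have "\<dots> \<le> wt U" by (rule open_weight_split[OF U(1) V])
      finally show "outer (A \<inter> V) + outer (A - V) \<le> wt U" .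
    qed
    have "(A \<inter> V) \<union> (A - V) = A" by auto
    then show "outer A \<le> outer (A \<inter> V) + outer (A - V)"
      using sub[of "A \<inter> V" "A - V"] by auto
  qed
  then show ?thesis by (simp add: S.lambda_system_eq)
qed

definition regular_measure :: "'a measure" where
  "regular_measure = measure_of UNIV (sets borel) outer"

lemma sets_regular_measure [simp]: "sets regular_measure = sets borel"
  unfolding regular_measure_def using sets.space_closed[of "borel :: 'a measure"]
  by (metis sets_measure_of sets.sigma_sets_eq space_borel)

text \<open>Caratheodory's theorem makes \<open>outer\<close> countably additive on the measurable
  sets \<open>?L\<close>, which contain the open sets and therefore all Borel sets.\<close>

lemma emeasure_regular_measure: "A \<in> sets borel \<Longrightarrow> emeasure regular_measure A = outer A"
proof -
  interpret S: sigma_algebra UNIV "UNIV :: 'a set set"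
    using sigma_algebra_Pow[of UNIV] by simp
  let ?L = "lambda_system UNIV UNIV outer"
  have L: "measure_space UNIV ?L outer"
    by (rule S.caratheodory_lemma[OF outer_measure_space_regular_outer])
  then interpret L: sigma_algebra UNIV ?L by (simp add: measure_space_def)
  have sub: "sets borel \<subseteq> ?L"
    unfolding borel_def sets_measure_of[OF subset_UNIV[of "Collect open", folded Pow_UNIV]]
    by (intro L.sigma_sets_subset) (auto intro: open_in_lambda_system)
  assume "A \<in> sets borel"
  then show ?thesis
    unfolding regular_measure_def
  proof (intro emeasure_measure_of_sigma)
    show "sigma_algebra UNIV (sets (borel :: 'a measure))"
      using sets.sigma_algebra_axioms[of "borel :: 'a measure"] by simp
    show "positive (sets borel) outer" "countably_additive (sets borel) outer"
      using L sub by (auto simp: measure_space_def positive_def countably_additive_def subset_eq)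
  qed
qed

lemma prob_space_regular_measure: "prob_space regular_measure"
proof
  have "space regular_measure = UNIV" by (simp add: regular_measure_def space_measure_of_conv)
  moreover have "wt UNIV = 1"
    by (auto simp: open_weight_def erosion_def total)
  ultimately show "emeasure regular_measure (space regular_measure) = 1"
    by (simp add: emeasure_regular_measure regular_outer_open)
qed

text \<open>A compact subset of an open set \<open>U\<close> lies in one of its erosions: the radius
  is a Lebesgue number of the one-member cover \<open>{U}\<close>. Bounds for measures thereby
  become bounds for means on closed sets.\<close>

lemma measure_regular_measure_ge:
  assumes C: "closed C"
  shows "m C \<le> measure regular_measure C"
proof -
  interpret prob_space regular_measure by (rule prob_space_regular_measure)
  have "compact C" using closed_Int_compact[OF C compact_space] by simp
  have "ennreal (m C) \<le> outer C"
    unfolding regular_outer_def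
  proof (rule INF_greatest)
    fix U assume "U \<in> {U. open U \<and> C \<subseteq> U}"
    then have U: "C \<subseteq> \<Union>{U}" "\<And>V. V \<in> {U} \<Longrightarrow> open V" by simp_all
    show "ennreal (m C) \<le> wt U"
    proof (rule Heine_Borel_lemma[OF \<open>compact C\<close> U])
      fix e :: real assume e: "0 < e" "\<And>x. x \<in> C \<Longrightarrow> \<exists>V\<in>{U}. ball x e \<subseteq> V"
      have "C \<subseteq> erosion e U" using e(2) by (simp add: erosion_def subset_eq)
      then have "ennreal (m C) \<le> ennreal (m (erosion e U))" by (intro ennreal_leI mono)
      also have "\<dots> \<le> wt U" by (rule erosion_le_open_weight[OF e(1)])
      finally show "ennreal (m C) \<le> wt U" .
    qed simp_all
  qed
  then show ?thesis
    using C by (simp add: emeasure_regular_measure[symmetric] emeasure_eq_measure)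
qed

text \<open>Uniform continuity of \<open>h\<close> carries an erosion radius over to the preimage.
  This yields one inequality only; the converse comes from the inverse map in
  \<open>distr_regular_measure\<close>.\<close>

lemma open_weight_vimage:
  assumes h: "continuous_on UNIV h" and m: "\<And>A. m (h -` A) = m A"
  shows "wt U \<le> wt (h -` U)"
  unfolding open_weight_def[of m U]
proof (rule SUP_least)
  fix e :: real assume "e \<in> {0<..}"
  then obtain d where d: "0 < d" "\<And>x y. dist y x < d \<Longrightarrow> dist (h y) (h x) < e"
    using compact_uniformly_continuous[OF h compact_space] unfolding uniformly_continuous_on_def
    by (metis UNIV_I greaterThan_iff)
  have "h -` erosion e U \<subseteq> erosion d (h -` U)"
    using d(2) by (force simp: erosion_def dist_commute)
  then have "m (erosion e U) \<le> m (erosion d (h -` U))"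
    using m[of "erosion e U"] mono by metis
  then show "ennreal (m (erosion e U)) \<le> wt (h -` U)"
    using d(1) by (meson ennreal_leI erosion_le_open_weight order_trans)
qed

lemma distr_regular_measure:
  assumes h: "homeomorphism UNIV UNIV h k" and m: "\<And>A. m (h -` A) = m A"
  shows "distr regular_measure borel h = regular_measure"
proof -
  have hk: "h -` k -` A = A" "k -` h -` A = A" for A
    using h by (auto simp: homeomorphism_def)
  have ch: "continuous_on UNIV h" and ck: "continuous_on UNIV k"
    using h by (auto simp: homeomorphism_def)
  have mk: "m (k -` A) = m A" for A
    using m[of "k -` A"] by (simp add: hk)
  have le: "outer (h' -` A) \<le> outer A"
    if "continuous_on UNIV h'" "\<And>U. wt (h' -` U) \<le> wt U" for h' A
    unfolding regular_outer_def[of m A]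
  proof (rule INF_greatest)
    fix U assume "U \<in> {U. open U \<and> A \<subseteq> U}"
    then have "outer (h' -` A) \<le> wt (h' -` U)"
      using that(1) by (intro regular_outer_le open_vimage) auto
    also have "\<dots> \<le> wt U" by (rule that(2))
    finally show "outer (h' -` A) \<le> wt U" .
  qed
  have "outer (h -` A) \<le> outer A" for A
    using open_weight_vimage[OF ck mk, of "h -` _"] by (intro le[OF ch]) (simp add: hk)
  moreover have "outer A \<le> outer (h -` A)" for A
    using open_weight_vimage[OF ch m, of "k -` _"] le[OF ck, of "h -` A"] by (simp add: hk)
  ultimately have eq: "outer (h -` A) = outer A" for A by (simp add: antisym)
  have hm: "h \<in> borel_measurable borel"
    by (rule borel_measurable_continuous_onI[OF ch])
  show ?thesis
  proof (rule measure_eqI)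
    fix A assume "A \<in> sets (distr regular_measure borel h)"
    then have A: "A \<in> sets borel" by simp
    have "space regular_measure = UNIV" by (simp add: regular_measure_def space_measure_of_conv)
    moreover have "h -` A \<in> sets borel"
      using measurable_sets[OF hm A] by simp
    ultimately show "emeasure (distr regular_measure borel h) A = emeasure regular_measure A"
      using A hm by (simp add: emeasure_distr emeasure_regular_measure eq
          measurable_cong_sets[OF sets_regular_measure refl])
  qed simp
qed

end

section \<open>Smallness uniform over all means\<close>

context dynamics
begin

lemma mean_le_invariant_prob:
  assumes "mean m"
  obtains \<mu> where "invariant_prob G act \<mu>" "\<And>C. closed C \<Longrightarrow> m C \<le> measure \<mu> C"
proof -
  interpret compact_finadd_prob m
    using mean_finadd[OF assms] compact_space
    by (simp add: compact_finadd_prob_def compact_finadd_prob_axioms_def)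
  have "invariant_prob G act regular_measure"
    using prob_space_regular_measure distr_regular_measure[OF homeomorphism_act] mean_vimage[OF assms]
    by (auto simp: invariant_prob_def)
  then show thesis using that measure_regular_measure_ge by blast
qed

text \<open>By contradiction and compactness: means exceeding \<open>\<eta>\<close> on shrinking
  neighbourhoods \<open>U n\<close> have a cluster point with mass at least \<open>\<eta>\<close> on
  every \<open>U k\<close>. A dominating measure gives the closed neighbourhoods \<open>D k\<close>
  mass at least \<open>\<eta>\<close>, and by continuity from above also \<open>C\<close>.\<close>

lemma null_closed_neighbourhood:
  assumes C: "closed C" and null: "\<And>\<mu>. invariant_prob G act \<mu> \<Longrightarrow> measure \<mu> C = 0" and "0 < \<eta>"
  shows "\<exists>U. open U \<and> C \<subseteq> U \<and> (\<forall>m. mean m \<longrightarrow> m U \<le> \<eta>)"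
\<comment> \<open>\<open>infdist\<close> to the empty set is 0 by convention, so the neighbourhoods
  used below would be the whole space.\<close>
proof (cases "C = {}")
  case True
  have "m {} \<le> \<eta>" if "mean m" for m
    using finadd_prob.empty[OF mean_finadd[OF that]] \<open>0 < \<eta>\<close> by simp
  then show ?thesis using True by blast
next
  case False
  define r where "r n = inverse (real (Suc n))" for n
  have rpos: "0 < r n" for n by (simp add: r_def)
  have rdec: "r n \<le> r k" if "k \<le> n" for k n
    using that by (simp add: r_def field_simps)
  have rlim: "r \<longlonglongrightarrow> 0"
    unfolding r_def by (rule LIMSEQ_inverse_real_of_nat)
  define U where "U n = {x. infdist x C < r n}" for n
  define D where "D n = {x. infdist x C \<le> r n}" for n
  have openU: "open (U n)" for n
    unfolding U_def by (intro open_Collect_less continuous_intros)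
  have closedD: "closed (D n)" for n
    unfolding D_def by (intro closed_Collect_le continuous_intros)
  have CU: "C \<subseteq> U n" for n using rpos by (auto simp: U_def)
  have "(\<Inter>n. D n) = C"
  proof
    show "C \<subseteq> (\<Inter>n. D n)" using rpos by (auto simp: D_def less_imp_le)
    show "(\<Inter>n. D n) \<subseteq> C"
    proof
      fix x assume "x \<in> (\<Inter>n. D n)"
      then have "infdist x C \<le> r n" for n by (auto simp: D_def)
      then have "infdist x C \<le> 0"
        by (intro LIMSEQ_le_const[OF rlim]) auto
      then have "infdist x C = 0" using infdist_nonneg[of x C] by simp
      then show "x \<in> C" using in_closed_iff_infdist_zero[OF C False] by simp
    qed
  qed
  show ?thesis
  proof (rule ccontr)
    assume contr: "\<not> ?thesis"
    then have "\<exists>m. mean m \<and> \<eta> < m (U n)" for n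
      using openU CU by (meson not_le)
    then obtain p where p: "\<And>n. mean (p n)" "\<And>n. \<eta> < p n (U n)" by metis
    have "\<forall>\<^sub>F n in sequentially. finadd_prob (p n)"
      using mean_finadd[OF p(1)] by simp
    then obtain m where m: "\<And>S. closed S \<Longrightarrow> \<forall>\<^sub>F n in sequentially. p n \<in> S \<Longrightarrow> m \<in> S"
      using finadd_prob_cluster_point[OF sequentially_bot] by blast
    have "mean m"
      using m[OF closed_invariant_mean[of G act]] p(1) by auto
    have mU: "\<eta> \<le> m (U k)" for k
    proof -
      have "m \<in> {q. \<eta> \<le> q (U k)}"
      proof (rule m)
        show "closed {q. \<eta> \<le> q (U k)}"
          by (intro closed_Collect_le continuous_intros continuous_eval)
        show "\<forall>\<^sub>F n in sequentially. p n \<in> {q. \<eta> \<le> q (U k)}"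
          using eventually_ge_at_top[of k]
        proof eventually_elim
          case (elim n)
          have "U n \<subseteq> U k"
            using rdec[OF elim] by (auto simp: U_def)
          then show ?case
            using p(2)[of n] finadd_prob.mono[OF mean_finadd[OF p(1)], of "U n" "U k" n] by auto
        qed
      qed
      then show ?thesis by simp
    qed
    obtain \<mu> where \<mu>: "invariant_prob G act \<mu>" "\<And>C. closed C \<Longrightarrow> m C \<le> measure \<mu> C"
      using mean_le_invariant_prob[OF \<open>mean m\<close>] by metis
    interpret prob_space \<mu> using \<mu>(1) by (simp add: invariant_prob_def)
    have sets: "sets \<mu> = sets borel" using \<mu>(1) by (simp add: invariant_prob_def)
    have "\<eta> \<le> measure \<mu> (D k)" for k
    proof -
      have "m (U k) \<le> m (D k)"
        by (rule finadd_prob.mono[OF mean_finadd[OF \<open>mean m\<close>]]) (auto simp: U_def D_def)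
      then show ?thesis using mU[of k] \<mu>(2)[OF closedD, of k] by linarith
    qed
    moreover have "(\<lambda>n. measure \<mu> (D n)) \<longlonglongrightarrow> measure \<mu> (\<Inter>n. D n)"
    proof (rule finite_Lim_measure_decseq)
      show "range D \<subseteq> sets \<mu>" using closedD by (auto simp: sets)
      show "decseq D"
      proof (rule decseq_SucI)
        show "D (Suc n) \<subseteq> D n" for n
          using rdec[of n "Suc n"] by (auto simp: D_def)
      qed
    qed
    ultimately have "\<eta> \<le> measure \<mu> C"
      unfolding \<open>(\<Inter>n. D n) = C\<close> by (intro LIMSEQ_le_const) auto
    with null[OF \<mu>(1)] \<open>0 < \<eta>\<close> show False by simp
  qed
qed

end

section \<open>Quasi-tilings\<close>

context dynamics
begin

lemma finite_set_mult: "finite A \<Longrightarrow> finite B \<Longrightarrow> finite (A <#> B)"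
  by (simp add: set_mult_def)

lemma set_mult_mono: "B \<subseteq> C \<Longrightarrow> A <#> B \<subseteq> A <#> C"
  by (auto simp: set_mult_def)

section \<open>A translation-invariant algebra of sets with null boundary\<close>

definition boundary_null :: "'x set \<Rightarrow> bool" where
  "boundary_null A \<longleftrightarrow> (\<forall>\<mu>. invariant_prob G act \<mu> \<longrightarrow> measure \<mu> (frontier A) = 0)"

lemma boundary_null_mono:
  assumes "boundary_null A" "boundary_null B" "frontier C \<subseteq> frontier A \<union> frontier B"
  shows "boundary_null C"
  unfolding boundary_null_def
proof (intro allI impI)
  fix \<mu> assume \<mu>: "invariant_prob G act \<mu>"
  interpret prob_space \<mu> using \<mu> by (simp add: invariant_prob_def)
  have sets: "sets \<mu> = sets borel" using \<mu> by (simp add: invariant_prob_def)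
  have fr: "frontier S \<in> sets \<mu>" for S by (simp add: sets)
  have "measure \<mu> (frontier C) \<le> measure \<mu> (frontier A \<union> frontier B)"
    using fr by (intro finite_measure_mono assms(3)) auto
  also have "\<dots> \<le> measure \<mu> (frontier A) + measure \<mu> (frontier B)"
    using fr by (intro measure_Un_le) auto
  also have "\<dots> = 0" using assms(1,2) \<mu> by (simp add: boundary_null_def)
  finally show "measure \<mu> (frontier C) = 0" by (simp add: measure_le_0_iff)
qed

lemma boundary_null_UNIV: "boundary_null UNIV"
  by (simp add: boundary_null_def)

lemma boundary_null_Compl: "boundary_null A \<Longrightarrow> boundary_null (- A)"
  by (simp add: boundary_null_def frontier_complement)

lemma boundary_null_Int: "boundary_null A \<Longrightarrow> boundary_null B \<Longrightarrow> boundary_null (A \<inter> B)"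
  by (rule boundary_null_mono[of A B]) (auto simp: frontier_Int)

lemma boundary_null_INT:
  "finite I \<Longrightarrow> (\<And>i. i \<in> I \<Longrightarrow> boundary_null (A i)) \<Longrightarrow> boundary_null (\<Inter>i\<in>I. A i)"
  by (induction I rule: finite_induct) (auto simp: boundary_null_UNIV intro!: boundary_null_Int)

lemma boundary_null_UN:
  assumes "finite I" "\<And>i. i \<in> I \<Longrightarrow> boundary_null (A i)"
  shows "boundary_null (\<Union>i\<in>I. A i)"
  using boundary_null_Compl[OF boundary_null_INT[of I "\<lambda>i. - A i"]] assms boundary_null_Compl
  by simp

text \<open>Continuity puts the frontier of the preimage inside the preimage of the frontier, which
  by invariance has the measure of the frontier itself.\<close>

lemma boundary_null_vimage:
  assumes A: "boundary_null A" and g: "g \<in> carrier G"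
  shows "boundary_null ((\<lambda>x. act x g) -` A)"
  unfolding boundary_null_def
proof (intro allI impI)
  fix \<mu> assume \<mu>: "invariant_prob G act \<mu>"
  interpret prob_space \<mu> using \<mu> by (simp add: invariant_prob_def)
  let ?h = "\<lambda>x. act x g"
  have sets: "sets \<mu> = sets borel" and distr: "distr \<mu> borel ?h = \<mu>"
    using \<mu> g by (auto simp: invariant_prob_def)
  have space: "space \<mu> = UNIV" using sets_eq_imp_space_eq[OF sets] by simp
  have cont: "continuous_on UNIV ?h" by (rule continuous_act[OF g])
  have hm: "?h \<in> measurable \<mu> borel"
    using borel_measurable_continuous_onI[OF cont] measurable_cong_sets[OF sets refl] by blast
  have "closure (?h -` A) \<subseteq> ?h -` closure A"
    using cont by (intro closure_minimal vimage_mono closure_subset closed_vimage) auto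
  moreover have "?h -` interior A \<subseteq> interior (?h -` A)"
    using cont by (intro interior_maximal vimage_mono interior_subset open_vimage) auto
  ultimately have "frontier (?h -` A) \<subseteq> ?h -` frontier A"
    by (auto simp: frontier_def)
  then have "measure \<mu> (frontier (?h -` A)) \<le> measure \<mu> (?h -` frontier A)"
    using measurable_sets[OF hm, of "frontier A"] by (intro finite_measure_mono) (auto simp: space)
  also have "\<dots> = measure (distr \<mu> borel ?h) (frontier A)"
    using hm by (simp add: measure_distr space)
  also have "\<dots> = 0" using A \<mu> by (simp add: distr boundary_null_def)
  finally show "measure \<mu> (frontier (?h -` A)) = 0" by (simp add: measure_le_0_iff)
qed

lemma boundary_null_image: "boundary_null A \<Longrightarrow> g \<in> carrier G \<Longrightarrow> boundary_null ((\<lambda>x. act x g) ` A)"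
  by (simp add: act_image boundary_null_vimage)

text \<open>An open neighbourhood of the frontier that is small for all means is removed from
  \<open>closure W\<close>; what remains is closed and, missing the frontier, lies in
  \<open>W\<close>.\<close>

lemma boundary_null_closed_core:
  assumes W: "boundary_null W" and "0 < \<eta>"
  shows "\<exists>B. closed B \<and> B \<subseteq> W \<and> (\<forall>m. mean m \<longrightarrow> m (W - B) \<le> \<eta>)"
proof -
  obtain U where U: "open U" "frontier W \<subseteq> U" "\<And>m. mean m \<Longrightarrow> m U \<le> \<eta>"
    using null_closed_neighbourhood[of "frontier W" \<eta>] W \<open>0 < \<eta>\<close>
    by (auto simp: boundary_null_def)
  have "closure W - U \<subseteq> W"
    using U(2) interior_subset by (auto simp: frontier_def)
  moreover have "m (W - (closure W - U)) \<le> \<eta>" if "mean m" for m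
    using finadd_prob.mono[OF mean_finadd[OF that], of "W - (closure W - U)" U] U(3)[OF that]
      closure_subset[of W] by fastforce
  ultimately show ?thesis
    using U(1) by (intro exI[of _ "closure W - U"]) auto
qed

text \<open>The condition for \<open>U\<close> to be the base of a Rokhlin tower of shape
  \<open>F\<close>. The pointwise form passes to subsets of \<open>U\<close> immediately.\<close>

definition separated :: "'g set \<Rightarrow> 'x set \<Rightarrow> bool" where
  "separated F U \<longleftrightarrow> (\<forall>u\<in>U. \<forall>v\<in>U. \<forall>g\<in>F. \<forall>h\<in>F. act u g = act v h \<longrightarrow> g = h)"

lemma separatedD:
  "separated F U \<Longrightarrow> u \<in> U \<Longrightarrow> v \<in> U \<Longrightarrow> g \<in> F \<Longrightarrow> h \<in> F \<Longrightarrow> act u g = act v h \<Longrightarrow> g = h"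
  by (simp add: separated_def)

text \<open>By freeness the points \<open>act y g\<close> with \<open>g\<close> in \<open>F\<close>
  are distinct; near \<open>y\<close> each of them moves by less than half of a lower bound for
  their distances.\<close>

lemma separated_neighbourhood:
  assumes free: "free_system G act" and F: "finite F" "F \<subseteq> carrier G"
  obtains V where "open V" "y \<in> V" "separated F V"
proof -
  let ?d = "\<lambda>(g, h). dist (act y g) (act y h)"
  let ?P = "{p\<in>F \<times> F. fst p \<noteq> snd p}"
  have pos: "0 < ?d p" if p: "p \<in> ?P" for p
  proof -
    obtain g h where p: "p = (g, h)" "g \<in> carrier G" "h \<in> carrier G" "g \<noteq> h"
      using p F by (cases p) auto
    have "act y g \<noteq> act y h"
    proof
      assume "act y g = act y h"
      then have "act y (g \<otimes> inv h) = y"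
        using p act_mult[of g "inv h" y] by simp
      then have "g \<otimes> inv h = \<one>" using free p by (simp add: free_system_def)
      then show False using p by (metis inv_closed inv_equality inv_inv)
    qed
    then show ?thesis by (simp add: p)
  qed
  obtain e where e: "0 < e" "\<And>p. p \<in> ?P \<Longrightarrow> e \<le> ?d p"
  proof
    \<comment> \<open>Inserting 1 keeps \<open>Min\<close> meaningful when \<open>F\<close> has at
      most one element and there are no pairs.\<close>
    show "0 < Min (insert 1 (?d ` ?P))"
      using F pos by (subst Min_gr_iff) auto
    show "Min (insert 1 (?d ` ?P)) \<le> ?d p" if "p \<in> ?P" for p
      using F that by (intro Min_le) auto
  qed
  define V where "V = (\<Inter>g\<in>F. (\<lambda>x. act x g) -` ball (act y g) (e / 2))"
  show thesis
  proof
    show "open V"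
      unfolding V_def using F continuous_act by (intro open_INT open_vimage ballI) auto
    show "y \<in> V" using e(1) by (simp add: V_def)
    show "separated F V"
      unfolding separated_def
    proof (intro ballI impI, rule ccontr)
      fix u v g h assume *: "u \<in> V" "v \<in> V" "g \<in> F" "h \<in> F" "act u g = act v h" and "g \<noteq> h"
      then have "e \<le> dist (act y g) (act y h)" using e(2)[of "(g, h)"] * by simp
      moreover have "dist (act y g) (act u g) < e / 2" "dist (act y h) (act u g) < e / 2"
        using * by (auto simp: V_def)
      ultimately show False
        using dist_triangle2[of "act y g" "act y h" "act u g"] by simp
    qed
  qed
qed

lemma separated_cover:
  assumes free: "free_system G act" and sbp: "small_boundary_property G act"
    and F: "finite F" "F \<subseteq> carrier G"
  obtains \<U> where "finite \<U>" "\<Union>\<U> = UNIV" "\<And>U. U \<in> \<U> \<Longrightarrow> boundary_null U"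
    "\<And>U. U \<in> \<U> \<Longrightarrow> separated F U"
proof -
  define good where "good U \<longleftrightarrow> open U \<and> boundary_null U \<and> separated F U" for U
  obtain \<B> where \<B>: "topological_basis \<B>" "\<And>U. U \<in> \<B> \<Longrightarrow> boundary_null U"
    using sbp by (auto simp: small_boundary_property_def boundary_null_def)
  have "\<exists>U. good U \<and> y \<in> U" for y
  proof -
    obtain V where V: "open V" "y \<in> V" "separated F V"
      by (rule separated_neighbourhood[OF free F])
    obtain U where "U \<in> \<B>" "y \<in> U" "U \<subseteq> V"
      using topological_basisE[OF \<B>(1) V(1,2)] by metis
    then have "good U \<and> y \<in> U"
      using V(3) \<B>(2) topological_basis_open[OF \<B>(1)] unfolding good_def separated_def by blast
    then show ?thesis by blast
  qed
  then have "UNIV \<subseteq> \<Union>{U. good U}" by auto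
  then obtain \<U> where "\<U> \<subseteq> {U. good U}" "finite \<U>" "UNIV \<subseteq> \<Union>\<U>"
    using compactE[OF compact_space, of "{U. good U}"] by (metis good_def mem_Collect_eq)
  then show thesis
    by (intro that[of \<U>]) (auto simp: good_def subset_eq)
qed

section \<open>Castles and their greedy extension\<close>

definition translates :: "'x set \<Rightarrow> 'g set \<Rightarrow> 'x set" where
  "translates W F = (\<Union>g\<in>F. (\<lambda>x. act x g) ` W)"

definition castle_cover :: "('x set \<times> 'g set \<times> 'g set) set \<Rightarrow> 'x set" where
  "castle_cover T = (\<Union>(W, D, F)\<in>T. translates W F)"

text \<open>
  A tower is a triple \<open>(W, D, F)\<close>: \<open>W\<close> is the base, \<open>D\<close> the shape before and \<open>F\<close> the shape after
  trimming. Both are recorded because trimming costs a fixed proportion \<open>\<epsilon>\<close>, so that only \<open>D\<close> can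
  be arbitrarily invariant; the cover contains the translates by all of \<open>D\<close>.
\<close>

definition castle ::
  "real \<Rightarrow> 'g set \<Rightarrow> real \<Rightarrow> ('x set \<times> 'g set \<times> 'g set) set \<Rightarrow> bool" where
  "castle \<epsilon> K \<delta> T \<longleftrightarrow> finite T \<and>
     (\<forall>(W, D, F)\<in>T. boundary_null W \<and> finite D \<and> D \<noteq> {} \<and> D \<subseteq> carrier G \<and> F \<subseteq> D \<and>
        (1 - \<epsilon>) * real (card D) \<le> card F \<and> card ((D <#> K) - D) \<le> \<delta> * real (card D) \<and>
        translates W D \<subseteq> castle_cover T) \<and>
     (\<forall>W D F W' D' F' w w' g g'. (W, D, F) \<in> T \<longrightarrow> (W', D', F') \<in> T \<longrightarrow>
        w \<in> W \<longrightarrow> w' \<in> W' \<longrightarrow> g \<in> F \<longrightarrow> g' \<in> F' \<longrightarrow> act w g = act w' g' \<longrightarrow>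
        (W, D, F) = (W', D', F') \<and> g = g')"

lemma castle_finite: "castle \<epsilon> K \<delta> T \<Longrightarrow> finite T"
  by (simp add: castle_def)

lemma castle_tower:
  assumes "castle \<epsilon> K \<delta> T" and p: "(W, D, F) \<in> T"
  shows "boundary_null W" and "finite D" and "D \<noteq> {}" and "D \<subseteq> carrier G" and "F \<subseteq> D"
    and "(1 - \<epsilon>) * real (card D) \<le> card F" and "card ((D <#> K) - D) \<le> \<delta> * real (card D)"
    and "translates W D \<subseteq> castle_cover T"
  using bspec[OF assms(1)[unfolded castle_def, THEN conjunct2, THEN conjunct1] p] by simp_all

lemma castle_disjoint:
  assumes T: "castle \<epsilon> K \<delta> T"
    and p: "(W, D, F) \<in> T" "(W', D', F') \<in> T" "w \<in> W" "w' \<in> W'" "g \<in> F" "g' \<in> F'"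
    and eq: "act w g = act w' g'"
  shows "(W, D, F) = (W', D', F') \<and> g = g'"
  using T[unfolded castle_def, THEN conjunct2, THEN conjunct2, rule_format, OF p eq] .

lemma boundary_null_castle_cover:
  assumes "castle \<epsilon> K \<delta> T"
  shows "boundary_null (castle_cover T)"
  unfolding castle_cover_def translates_def
proof (rule boundary_null_UN[OF castle_finite[OF assms]])
  fix p assume "p \<in> T"
  obtain W D F where p: "p = (W, D, F)" by (cases p)
  have "finite F" "F \<subseteq> carrier G" "boundary_null W"
    using castle_tower[OF assms, of W D F] \<open>p \<in> T\<close> finite_subset[of F D] by (auto simp: p)
  then show "boundary_null (case p of (W, D, F) \<Rightarrow> \<Union>g\<in>F. (\<lambda>x. act x g) ` W)"
    by (auto simp: p intro!: boundary_null_UN boundary_null_image)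
qed

text \<open>\<open>J u\<close> is the part of the window at \<open>u\<close> that is still free.
  Points of \<open>U\<close> sharing a free part \<open>I\<close> of at least the proportion
  \<open>1 - \<epsilon>\<close> form the base \<open>P I\<close> of a new tower with trimmed shape
  \<open>I\<close>; at all other points the proportion \<open>\<epsilon>\<close> is covered already.
  The bases have null boundary as finite Boolean combinations of \<open>U\<close> and translates of
  \<open>A\<close>.\<close>

lemma castle_extend_one:
  assumes T: "castle \<epsilon> K \<delta> T" and \<epsilon>: "0 < \<epsilon>" "\<epsilon> \<le> 1" and U: "boundary_null U"
    and F: "finite F" "F \<noteq> {}" "F \<subseteq> carrier G" "card ((F <#> K) - F) \<le> \<delta> * real (card F)"
    and sep: "separated F U"
  obtains T' where "castle \<epsilon> K \<delta> T'" "castle_cover T \<subseteq> castle_cover T'"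
    "\<And>u. u \<in> U \<Longrightarrow> \<epsilon> * real (card F) \<le> card {f\<in>F. act u f \<in> castle_cover T'}"
proof -
  define A where "A = castle_cover T"
  define J where "J u = {f\<in>F. act u f \<notin> A}" for u
  define P where "P I = {u\<in>U. J u = I}" for I
  define New where "New = (\<lambda>I. (P I, F, I)) ` {I\<in>Pow F. (1 - \<epsilon>) * real (card F) \<le> card I}"
  define T' where "T' = T \<union> New"
  have finNew: "finite New" using F(1) by (simp add: New_def)
  have cover': "castle_cover T' = A \<union> castle_cover New"
    by (simp add: T'_def A_def castle_cover_def)
  have bnA: "boundary_null A"
    unfolding A_def by (rule boundary_null_castle_cover[OF T])
  have bnP: "boundary_null (P I)" if "I \<subseteq> F" for I
  proof -
    have "P I = U \<inter> (\<Inter>f\<in>F. if f \<in> I then - ((\<lambda>x. act x f) -` A) else (\<lambda>x. act x f) -` A)"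
      using that by (auto simp: P_def J_def split: if_splits)
    also have "boundary_null \<dots>"
      using U F bnA
      by (intro boundary_null_Int boundary_null_INT)
        (auto intro!: boundary_null_Compl boundary_null_vimage)
    finally show ?thesis .
  qed
  have New: "\<exists>I. W = P I \<and> D = F \<and> F' = I \<and> I \<subseteq> F \<and> (1 - \<epsilon>) * real (card F) \<le> card I"
    if "(W, D, F') \<in> New" for W D F'
    using that by (auto simp: New_def)
  \<comment> \<open>The new towers make even the untrimmed window covered: positions in
    \<open>I\<close> by the tower itself, the others by the old cover \<open>A\<close>.\<close>
  have trans_New: "act u f \<in> castle_cover T'"
    if "I \<subseteq> F" "(1 - \<epsilon>) * real (card F) \<le> card I" "u \<in> P I" "f \<in> F" for I u f
  proof (cases "act u f \<in> A")
    case False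
    then have "f \<in> I" using that by (auto simp: P_def J_def)
    moreover have "(P I, F, I) \<in> T'" using that by (auto simp: T'_def New_def)
    ultimately show ?thesis using that(3) by (force simp: castle_cover_def translates_def)
  qed (simp add: cover')
  have old_in: "act w g \<in> A" if "(W, D, F') \<in> T" "w \<in> W" "g \<in> F'" for W D F' w g
    using that by (force simp: A_def castle_cover_def translates_def)
  have new_out: "act w g \<notin> A" if "w \<in> P I" "g \<in> I" for I w g
    using that by (auto simp: P_def J_def)
  have "castle \<epsilon> K \<delta> T'"
    unfolding castle_def
  proof (intro conjI)
    show "finite T'" using castle_finite[OF T] finNew by (simp add: T'_def)
    show "\<forall>(W, D, F)\<in>T'. boundary_null W \<and> finite D \<and> D \<noteq> {} \<and> D \<subseteq> carrier G \<and> F \<subseteq> D \<and>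
        (1 - \<epsilon>) * real (card D) \<le> card F \<and> card ((D <#> K) - D) \<le> \<delta> * real (card D) \<and>
        translates W D \<subseteq> castle_cover T'"
    proof clarify
      fix W D F' assume "(W, D, F') \<in> T'"
      then consider "(W, D, F') \<in> T" | "(W, D, F') \<in> New" by (auto simp: T'_def)
      then show "boundary_null W \<and> finite D \<and> D \<noteq> {} \<and> D \<subseteq> carrier G \<and> F' \<subseteq> D \<and>
        (1 - \<epsilon>) * real (card D) \<le> card F' \<and> card ((D <#> K) - D) \<le> \<delta> * real (card D) \<and>
        translates W D \<subseteq> castle_cover T'"
      proof cases
        case 1
        then show ?thesis using castle_tower[OF T 1] by (auto simp: cover' A_def)
      next
        case 2
        then obtain I where I: "W = P I" "D = F" "F' = I" "I \<subseteq> F" "(1 - \<epsilon>) * real (card F) \<le> card I"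
          using New by blast
        have "translates W D \<subseteq> castle_cover T'"
          using trans_New[OF I(4,5)] by (auto simp: I translates_def)
        then show ?thesis using F bnP I by simp
      qed
    qed
    show "\<forall>W D F W' D' F' w w' g g'. (W, D, F) \<in> T' \<longrightarrow> (W', D', F') \<in> T' \<longrightarrow>
        w \<in> W \<longrightarrow> w' \<in> W' \<longrightarrow> g \<in> F \<longrightarrow> g' \<in> F' \<longrightarrow> act w g = act w' g' \<longrightarrow>
        (W, D, F) = (W', D', F') \<and> g = g'"
    proof (intro allI impI)
      fix W D E W' D' E' w w' g g'
      assume pq: "(W, D, E) \<in> T'" "(W', D', E') \<in> T'"
        and w: "w \<in> W" "w' \<in> W'" "g \<in> E" "g' \<in> E'" and eq: "act w g = act w' g'"
      consider "(W, D, E) \<in> T" "(W', D', E') \<in> T" | "(W, D, E) \<in> T" "(W', D', E') \<in> New"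
        | "(W, D, E) \<in> New" "(W', D', E') \<in> T" | "(W, D, E) \<in> New" "(W', D', E') \<in> New"
        using pq by (auto simp: T'_def)
      then show "(W, D, E) = (W', D', E') \<and> g = g'"
      proof cases
        case 1
        show ?thesis by (rule castle_disjoint[OF T 1 w eq])
      next
        \<comment> \<open>Old towers lie in \<open>A\<close>, trimmed new ones avoid it; the same
          settles the next case.\<close>
        case 2
        then show ?thesis using old_in[of W D E w g] New[of W' D' E'] new_out[of w' _ g'] w eq by auto
      next
        case 3
        then show ?thesis using old_in[of W' D' E' w' g'] New[of W D E] new_out[of w _ g] w eq by auto
      next
        \<comment> \<open>Separation gives equal positions, hence equal base points, hence equal
          free parts.\<close>
        case 4
        obtain I I' where I: "W = P I" "D = F" "E = I" "I \<subseteq> F" "W' = P I'" "D' = F" "E' = I'" "I' \<subseteq> F"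
          using New[OF 4(1)] New[OF 4(2)] by blast
        then have u: "w \<in> U" "w' \<in> U" "g \<in> F" "g' \<in> F" using w by (auto simp: P_def)
        then have "g = g'" using separatedD[OF sep] eq by blast
        then have "w = w'" using eq act_inj u F(3) by blast
        then have "I = I'" using w I by (auto simp: P_def)
        then show ?thesis using I \<open>g = g'\<close> by simp
      qed
    qed
  qed
  moreover have "\<epsilon> * real (card F) \<le> card {f\<in>F. act u f \<in> castle_cover T'}" if u: "u \<in> U" for u
  proof (cases "(1 - \<epsilon>) * real (card F) \<le> card (J u)")
    case True
    have "u \<in> P (J u)" "J u \<subseteq> F" using u by (auto simp: P_def J_def)
    then have "{f\<in>F. act u f \<in> castle_cover T'} = F"
      using trans_New[OF _ True] by blast
    then show ?thesis using \<epsilon> by (simp add: mult_left_le_one_le)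
  next
    case False
    have "card F = card (J u) + card {f\<in>F. act u f \<in> A}"
      using F(1) by (subst card_Un_disjoint[symmetric]) (auto simp: J_def intro!: arg_cong[of _ _ card])
    moreover have "card {f\<in>F. act u f \<in> A} \<le> card {f\<in>F. act u f \<in> castle_cover T'}"
      using F(1) by (intro card_mono) (auto simp: cover')
    ultimately show ?thesis using False by (simp add: algebra_simps)
  qed
  ultimately show thesis using that by (simp add: cover' A_def)
qed

lemma castle_extend_many:
  assumes "finite \<U>" and T: "castle \<epsilon> K \<delta> T" and \<epsilon>: "0 < \<epsilon>" "\<epsilon> \<le> 1"
    and U: "\<And>U. U \<in> \<U> \<Longrightarrow> boundary_null U"
    and F: "finite F" "F \<noteq> {}" "F \<subseteq> carrier G" "card ((F <#> K) - F) \<le> \<delta> * real (card F)"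
    and sep: "\<And>U. U \<in> \<U> \<Longrightarrow> separated F U"
  shows "\<exists>T'. castle \<epsilon> K \<delta> T' \<and> castle_cover T \<subseteq> castle_cover T' \<and>
    (\<forall>u\<in>\<Union>\<U>. \<epsilon> * real (card F) \<le> card {f\<in>F. act u f \<in> castle_cover T'})"
  using assms(1) U sep
proof (induction \<U> rule: finite_induct)
  case empty
  then show ?case using T by auto
next
  case (insert V \<U>)
  obtain T1 where T1: "castle \<epsilon> K \<delta> T1" "castle_cover T \<subseteq> castle_cover T1"
    "\<And>u. u \<in> \<Union>\<U> \<Longrightarrow> \<epsilon> * real (card F) \<le> card {f\<in>F. act u f \<in> castle_cover T1}"
    using insert.IH[OF insert.prems(1)[OF insertI2] insert.prems(2)[OF insertI2]] by auto
  obtain T2 where T2: "castle \<epsilon> K \<delta> T2" "castle_cover T1 \<subseteq> castle_cover T2"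
    "\<And>u. u \<in> V \<Longrightarrow> \<epsilon> * real (card F) \<le> card {f\<in>F. act u f \<in> castle_cover T2}"
    by (rule castle_extend_one[OF T1(1) \<epsilon> insert.prems(1)[OF insertI1] F insert.prems(2)[OF insertI1]])
      (rule that)
  have "\<epsilon> * real (card F) \<le> card {f\<in>F. act u f \<in> castle_cover T2}" if "u \<in> \<Union>\<U>" for u
  proof -
    have "card {f\<in>F. act u f \<in> castle_cover T1} \<le> card {f\<in>F. act u f \<in> castle_cover T2}"
      using F(1) T2(2) by (intro card_mono) auto
    then show ?thesis using T1(3)[OF that] by simp
  qed
  then show ?case using T1(2) T2 by (intro exI[of _ T2]) auto
qed

text \<open>The trimmed towers are disjoint and each level of a tower has the mass of its base, so
  the left side is the mass of the cover.\<close>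

lemma castle_mass:
  assumes T: "castle \<epsilon> K \<delta> T" and m: "mean m"
  shows "(\<Sum>(W, D, F)\<in>T. real (card F) * m W) \<le> 1"
proof -
  interpret finadd_prob m by (rule mean_finadd[OF m])
  let ?I = "SIGMA p:T. snd (snd p)"
  let ?E = "\<lambda>(p, g). (\<lambda>x. act x g) ` fst p"
  have fin: "finite (snd (snd p))" and sub: "snd (snd p) \<subseteq> carrier G" if "p \<in> T" for p
    using castle_tower[OF T, of "fst p" "fst (snd p)" "snd (snd p)"] that
      finite_subset[of "snd (snd p)" "fst (snd p)"] by auto
  have "disjoint_family_on ?E ?I"
    unfolding disjoint_family_on_def
  proof (intro ballI impI)
    fix a b assume ab: "a \<in> ?I" "b \<in> ?I" "a \<noteq> b"
    obtain W D F g where a: "a = ((W, D, F), g)" by (metis surj_pair)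
    obtain W' D' F' g' where b: "b = ((W', D', F'), g')" by (metis surj_pair)
    show "?E a \<inter> ?E b = {}"
    proof (rule ccontr)
      assume "?E a \<inter> ?E b \<noteq> {}"
      then obtain w w' where "w \<in> W" "w' \<in> W'" "act w g = act w' g'" by (auto simp: a b)
      then have "(W, D, F) = (W', D', F') \<and> g = g'"
        using ab by (intro castle_disjoint[OF T]) (auto simp: a b)
      then show False using ab(3) by (simp add: a b)
    qed
  qed
  then have "m (\<Union>i\<in>?I. ?E i) = (\<Sum>i\<in>?I. m (?E i))"
    using castle_finite[OF T] fin by (intro finite_additive finite_SigmaI)
  also have "\<dots> = (\<Sum>p\<in>T. \<Sum>g\<in>snd (snd p). m (?E (p, g)))"
    using castle_finite[OF T] fin by (subst sum.Sigma) (auto simp: split_def)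
  also have "\<dots> = (\<Sum>p\<in>T. \<Sum>g\<in>snd (snd p). m (fst p))"
    using sub by (intro sum.cong refl) (auto simp: mean_image[OF m] subset_iff)
  also have "\<dots> = (\<Sum>(W, D, F)\<in>T. real (card F) * m W)"
    by (simp add: split_def)
  finally show ?thesis using le_1 by metis
qed

text \<open>An uncovered \<open>y\<close> with \<open>act y f\<close> covered equals
  \<open>act w (g \<otimes> inv f)\<close> for a base point \<open>w\<close>. This position lies in
  \<open>D <#> K\<close> but not in \<open>D\<close>, as the cover contains all of
  \<open>translates W D\<close>. Each tower has at most \<open>\<delta> * card D\<close> such
  positions, trimming at most halves a shape, and \<open>castle_mass\<close> bounds the
  total.\<close>

lemma castle_outer_boundary:
  assumes T: "castle \<epsilon> K \<delta> T" and \<epsilon>: "\<epsilon> \<le> 1/2" and \<delta>: "0 \<le> \<delta>" and m: "mean m"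
    and F: "F \<subseteq> carrier G" "(\<lambda>f. inv f) ` F \<subseteq> K" and K: "finite K" "K \<subseteq> carrier G"
  shows "m {y. y \<notin> castle_cover T \<and> (\<exists>f\<in>F. act y f \<in> castle_cover T)} \<le> 2 * \<delta>"
proof -
  interpret finadd_prob m by (rule mean_finadd[OF m])
  let ?N = "{y. y \<notin> castle_cover T \<and> (\<exists>f\<in>F. act y f \<in> castle_cover T)}"
  let ?I = "SIGMA p:T. (fst (snd p) <#> K) - fst (snd p)"
  let ?E = "\<lambda>(p, h). (\<lambda>x. act x h) ` fst p"
  have finT: "finite T" by (rule castle_finite[OF T])
  have fin: "finite ((fst (snd p) <#> K) - fst (snd p))"
    and sub: "fst (snd p) <#> K \<subseteq> carrier G" if "p \<in> T" for p
    using castle_tower(2,4)[OF T, of "fst p" "fst (snd p)" "snd (snd p)"] that K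
    by (auto simp: finite_set_mult set_mult_closed)
  have "?N \<subseteq> (\<Union>i\<in>?I. ?E i)"
  proof
    fix y assume "y \<in> ?N"
    then obtain f where y: "y \<notin> castle_cover T" "f \<in> F" "act y f \<in> castle_cover T" by auto
    then obtain W D F' w g where p: "(W, D, F') \<in> T" "w \<in> W" "g \<in> F'" "act y f = act w g"
      by (auto simp: castle_cover_def translates_def)
    have f: "f \<in> carrier G" and g: "g \<in> D" "g \<in> carrier G"
      using y F castle_tower(4,5)[OF T p(1)] p by auto
    have "y = act w (g \<otimes> inv f)"
      using f g p(4) by (metis act_inv(1) act_mult inv_closed)
    moreover have "g \<otimes> inv f \<in> D <#> K" using g F(2) y(2) by (auto simp: set_mult_def)
    moreover have "g \<otimes> inv f \<notin> D"
      using castle_tower(8)[OF T p(1)] y(1) p(2) \<open>y = act w (g \<otimes> inv f)\<close> by (auto simp: translates_def)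
    ultimately show "y \<in> (\<Union>i\<in>?I. ?E i)"
      using p(1,2) by (intro UN_I[of "((W, D, F'), g \<otimes> inv f)"]) auto
  qed
  then have "m ?N \<le> m (\<Union>i\<in>?I. ?E i)" by (rule mono)
  also have "\<dots> \<le> (\<Sum>i\<in>?I. m (?E i))"
    using finT fin by (intro UN_le finite_SigmaI)
  also have "\<dots> = (\<Sum>p\<in>T. \<Sum>h\<in>(fst (snd p) <#> K) - fst (snd p). m (?E (p, h)))"
    using finT fin by (subst sum.Sigma) (auto simp: split_def)
  also have "\<dots> = (\<Sum>p\<in>T. \<Sum>h\<in>(fst (snd p) <#> K) - fst (snd p). m (fst p))"
    using sub by (intro sum.cong refl) (auto simp: mean_image[OF m] subset_iff)
  also have "\<dots> \<le> (\<Sum>p\<in>T. 2 * \<delta> * (card (snd (snd p)) * m (fst p)))"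
  proof (rule sum_mono)
    fix p assume "p \<in> T"
    obtain W D F' where p: "p = (W, D, F')" by (cases p)
    have "1/2 * real (card D) \<le> (1 - \<epsilon>) * real (card D)"
      using \<epsilon> by (intro mult_right_mono) auto
    also have "\<dots> \<le> card F'" using castle_tower(6)[OF T] \<open>p \<in> T\<close> p by blast
    finally have "real (card D) \<le> 2 * real (card F')" by simp
    then have "\<delta> * real (card D) \<le> 2 * \<delta> * real (card F')"
      using mult_left_mono[OF _ \<delta>, of "real (card D)" "2 * real (card F')"] by simp
    then have "card ((D <#> K) - D) \<le> 2 * \<delta> * real (card F')"
      using castle_tower(7)[OF T] \<open>p \<in> T\<close> p by fastforce
    then have "card ((D <#> K) - D) * m W \<le> 2 * \<delta> * real (card F') * m W"
      by (intro mult_right_mono nonneg)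
    then show "(\<Sum>h\<in>(fst (snd p) <#> K) - fst (snd p). m (fst p)) \<le> 2 * \<delta> * (card (snd (snd p)) * m (fst p))"
      by (simp add: p mult.assoc)
  qed
  also have "\<dots> = 2 * \<delta> * (\<Sum>(W, D, F)\<in>T. real (card F) * m W)"
    by (simp add: sum_distrib_left split_def)
  also have "\<dots> \<le> 2 * \<delta> * 1"
    using \<delta> castle_mass[OF T m] by (intro mult_left_mono) auto
  finally show ?thesis by simp
qed

text \<open>The window at a point of \<open>?Z\<close> does not meet \<open>A\<close>, so its
  covered positions, at least the proportion \<open>\<epsilon>\<close>, all lie in
  \<open>A' - A\<close>. Integrating over the point gives
  \<open>\<epsilon> * m ?Z \<le> m (A' - A)\<close>.\<close>

lemma cover_gain:
  assumes m: "mean m" and F: "finite F" "F \<noteq> {}" "F \<subseteq> carrier G"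
    and sub: "A \<subseteq> A'" and dense: "\<And>y. \<epsilon> * real (card F) \<le> card {f\<in>F. act y f \<in> A'}" and \<epsilon>: "0 \<le> \<epsilon>"
  shows "m (- A') \<le> (1 - \<epsilon>) * m (- A) + \<epsilon> * m {y. y \<notin> A \<and> (\<exists>f\<in>F. act y f \<in> A)}"
proof -
  interpret finadd_prob m by (rule mean_finadd[OF m])
  let ?N = "{y. y \<notin> A \<and> (\<exists>f\<in>F. act y f \<in> A)}"
  let ?Z = "- A - ?N"
  have "(\<Sum>j\<in>{()}. \<epsilon> * real (card F) * m ?Z) \<le> (\<Sum>f\<in>F. 1 * m ((\<lambda>x. act x f) -` (A' - A)))"
  proof (rule sum_le_of_indicator)
    fix y
    have "\<epsilon> * real (card F) \<le> card {f\<in>F. act y f \<in> A' - A}" if "y \<in> ?Z"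
    proof -
      have "{f\<in>F. act y f \<in> A' - A} = {f\<in>F. act y f \<in> A'}" using that by auto
      then show ?thesis using dense[of y] by simp
    qed
    then show "(\<Sum>j\<in>{()}. \<epsilon> * real (card F) * indicator ?Z y) \<le>
        (\<Sum>f\<in>F. 1 * indicator ((\<lambda>x. act x f) -` (A' - A)) y)"
      using F(1) by (auto simp: indicator_def sum.If_cases Int_def)
  qed (use F in auto)
  also have "\<dots> = card F * m (A' - A)"
    using F by (simp add: mean_vimage[OF m] subset_eq)
  finally have 1: "\<epsilon> * m ?Z \<le> m (A' - A)"
    using F by (simp add: mult.commute mult.left_commute card_gt_0_iff)
  have "m ?Z = m (- A) - m ?N" by (rule diff) auto
  then have "\<epsilon> * m ?Z = \<epsilon> * m (- A) - \<epsilon> * m ?N" by (simp add: right_diff_distrib)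
  moreover have "m (A' - A) = m (- A) - m (- A')"
    using diff[OF sub] by (simp add: compl)
  ultimately show ?thesis using 1 by (simp add: algebra_simps)
qed

text \<open>The unit is inserted because the Folner condition is only available for nonempty test
  sets; \<open>D <#> K\<close> can only grow by this.\<close>

lemma exists_invariant_shape:
  assumes fol: "folner_sequence G F0" and K: "finite K" "K \<subseteq> carrier G" and \<delta>: "0 < \<delta>"
  obtains D where "finite D" "D \<noteq> {}" "D \<subseteq> carrier G" "card ((D <#> K) - D) \<le> \<delta> * real (card D)"
proof -
  have "\<forall>\<^sub>F n in sequentially. KE_invariant G (insert \<one> K) \<delta> (F0 n)"
    using fol K \<delta> by (simp add: folner_sequence_def)
  then obtain D where D: "KE_invariant G (insert \<one> K) \<delta> D"
    using eventually_happens by fastforce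
  then have fin: "finite D" "D \<noteq> {}" "D \<subseteq> carrier G" by (auto simp: KE_invariant_def)
  have "finite (D <#> insert \<one> K)" using fin(1) K(1) by (simp add: finite_set_mult)
  then have "card ((D <#> K) - D) \<le> card (sym_diff (D <#> insert \<one> K) D)"
    using fin(1) set_mult_mono[of K "insert \<one> K" D] by (intro card_mono) auto
  also have "\<dots> \<le> \<delta> * real (card D)"
    using D fin by (simp add: KE_invariant_def field_simps card_gt_0_iff)
  finally show thesis using fin that by simp
qed

text \<open>
  The shape \<open>F\<close> placed last is chosen first: the earlier shapes have to be invariant under \<open>F\<^sup>-\<^sup>1\<close>,
  whence the induction over all \<open>K\<close> and \<open>\<delta>\<close>.
\<close>

lemma exists_castle:
  assumes fol: "folner_sequence G F0" and free: "free_system G act" and sbp: "small_boundary_property G act"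
    and \<epsilon>: "0 < \<epsilon>" "\<epsilon> \<le> 1/2" and K: "finite K" "K \<subseteq> carrier G" and \<delta>: "0 < \<delta>"
  shows "\<exists>T. castle \<epsilon> K \<delta> T \<and> (\<forall>m. mean m \<longrightarrow> m (- castle_cover T) \<le> (1 - \<epsilon>) ^ n + \<delta>)"
  using K \<delta>
proof (induction n arbitrary: K \<delta>)
  case 0
  have "m (- castle_cover {}) \<le> (1 - \<epsilon>) ^ 0 + \<delta>" if "mean m" for m
    using finadd_prob.total[OF mean_finadd[OF that]] 0(3) by (simp add: castle_cover_def)
  moreover have "castle \<epsilon> K \<delta> {}" by (simp add: castle_def)
  ultimately show ?case by blast
next
  case (Suc n)
  obtain F where F: "finite F" "F \<noteq> {}" "F \<subseteq> carrier G" "card ((F <#> K) - F) \<le> \<delta> * real (card F)"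
    using exists_invariant_shape[OF fol Suc.prems] by metis
  \<comment> \<open>\<open>K\<close> keeps the invariance to be proved; the inverses of
    \<open>F\<close> make \<open>castle_outer_boundary\<close> applicable to the windows of shape
    \<open>F\<close>.\<close>
  let ?K = "K \<union> (\<lambda>f. inv f) ` F"
  have K': "finite ?K" "?K \<subseteq> carrier G" using Suc.prems F by auto
  obtain T where T: "castle \<epsilon> ?K (\<delta> / 2) T"
    and mT: "\<And>m. mean m \<Longrightarrow> m (- castle_cover T) \<le> (1 - \<epsilon>) ^ n + \<delta> / 2"
    using Suc.IH[OF K', of "\<delta> / 2"] Suc.prems by auto
  \<comment> \<open>Weakening to \<open>K\<close> and \<open>\<delta>\<close> lets the castle accept
    the new shape \<open>F\<close>, whose invariance is known only for these parameters.\<close>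
  have T0: "castle \<epsilon> K \<delta> T"
    unfolding castle_def
  proof (intro conjI)
    show "\<forall>(W, D, F)\<in>T. boundary_null W \<and> finite D \<and> D \<noteq> {} \<and> D \<subseteq> carrier G \<and> F \<subseteq> D \<and>
        (1 - \<epsilon>) * real (card D) \<le> card F \<and> card ((D <#> K) - D) \<le> \<delta> * real (card D) \<and>
        translates W D \<subseteq> castle_cover T"
    proof clarify
      fix W D E assume p: "(W, D, E) \<in> T"
      note c = castle_tower[OF T p]
      have "finite (D <#> ?K)" using c(2) K'(1) by (intro finite_set_mult)
      then have "card ((D <#> K) - D) \<le> card ((D <#> ?K) - D)"
        using set_mult_mono[of K ?K D] by (intro card_mono) auto
      also have "\<dots> \<le> \<delta> / 2 * real (card D)" by (rule c(7))
      also have "\<dots> \<le> \<delta> * real (card D)" using Suc.prems(3) by (intro mult_right_mono) auto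
      finally show "boundary_null W \<and> finite D \<and> D \<noteq> {} \<and> D \<subseteq> carrier G \<and> E \<subseteq> D \<and>
        (1 - \<epsilon>) * real (card D) \<le> card E \<and> card ((D <#> K) - D) \<le> \<delta> * real (card D) \<and>
        translates W D \<subseteq> castle_cover T"
        using c by simp
    qed
  qed (use T in \<open>auto simp: castle_def\<close>)
  obtain \<U> where \<U>: "finite \<U>" "\<Union>\<U> = UNIV" "\<And>U. U \<in> \<U> \<Longrightarrow> boundary_null U"
    "\<And>U. U \<in> \<U> \<Longrightarrow> separated F U"
    using separated_cover[OF free sbp F(1,3)] by metis
  have \<epsilon>1: "\<epsilon> \<le> 1" using \<epsilon> by simp
  obtain T' where T': "castle \<epsilon> K \<delta> T'" "castle_cover T \<subseteq> castle_cover T'"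
    "\<And>u. \<epsilon> * real (card F) \<le> card {f\<in>F. act u f \<in> castle_cover T'}"
    using castle_extend_many[OF \<U>(1) T0 \<epsilon>(1) \<epsilon>1 \<U>(3) F \<U>(4)] \<U>(2) by auto
  have "m (- castle_cover T') \<le> (1 - \<epsilon>) ^ Suc n + \<delta>" if m: "mean m" for m
  proof -
    let ?N = "{y. y \<notin> castle_cover T \<and> (\<exists>f\<in>F. act y f \<in> castle_cover T)}"
    have "m (- castle_cover T') \<le> (1 - \<epsilon>) * m (- castle_cover T) + \<epsilon> * m ?N"
      using \<epsilon> by (intro cover_gain[OF m F(1-3) T'(2,3)]) simp
    \<comment> \<open>Halving \<open>\<delta>\<close> in the induction pays for the boundary term:
      the errors add up to \<open>(1 + \<epsilon>) / 2 * \<delta>\<close>, at most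
      \<open>\<delta>\<close>.\<close>
    also have "\<dots> \<le> (1 - \<epsilon>) * ((1 - \<epsilon>) ^ n + \<delta> / 2) + \<epsilon> * (2 * (\<delta> / 2))"
      using \<epsilon> Suc.prems F K'
      by (intro add_mono mult_left_mono mT[OF m] castle_outer_boundary[OF T _ _ m]) auto
    also have "\<dots> = (1 - \<epsilon>) ^ Suc n + (1/2 + \<epsilon> / 2) * \<delta>"
      by (simp add: field_simps)
    also have "\<dots> \<le> (1 - \<epsilon>) ^ Suc n + 1 * \<delta>"
      using \<epsilon> Suc.prems(3) by (intro add_left_mono mult_right_mono) auto
    finally show ?thesis by simp
  qed
  with T'(1) show ?case by blast
qed

end

section \<open>Closed towers and extensions\<close>

context dynamics
begin

text \<open>\<open>(F <#> K) - F\<close> lies in the union of \<open>(D <#> K) - D\<close> and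
  \<open>D - F\<close>, which has at most \<open>(\<delta> + \<epsilon>) * card D\<close> elements.
  The factor 4 comes from \<open>card D \<le> 2 * card F\<close> and from
  \<open>F - (F <#> K)\<close> being no larger than \<open>(F <#> K) - F\<close>, as
  \<open>card F \<le> card (F <#> K)\<close>.\<close>

lemma KE_invariant_trim:
  assumes D: "finite D" "D \<noteq> {}" "D \<subseteq> carrier G" "F \<subseteq> D" "(1 - \<epsilon>) * real (card D) \<le> card F"
    "card ((D <#> K) - D) \<le> \<delta> * real (card D)"
    and K: "finite K" "K \<noteq> {}" "K \<subseteq> carrier G"
    and \<epsilon>: "0 \<le> \<epsilon>" "\<epsilon> \<le> 1/2" "0 \<le> \<delta>" "4 * (\<delta> + \<epsilon>) < \<eta>"
  shows "KE_invariant G K \<eta> F"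
proof -
  have fin: "finite F" "finite (F <#> K)" "finite (D <#> K)" and sub: "F \<subseteq> carrier G"
    using D(1,3,4) K(1) finite_subset[OF D(4,1)] by (auto intro!: finite_set_mult)
  have half: "real (card D) \<le> 2 * card F"
  proof -
    have "1/2 * real (card D) \<le> (1 - \<epsilon>) * real (card D)"
      using \<epsilon> by (intro mult_right_mono) auto
    then show ?thesis using D(5) by simp
  qed
  then have ne: "F \<noteq> {}" using D(1,2) by auto
  obtain k where k: "k \<in> K" using K(2) by blast
  have "inj_on (\<lambda>f. f \<otimes> k) F"
    using sub k K(3) by (intro inj_onI) (meson right_cancel subsetD)
  then have "card F = card ((\<lambda>f. f \<otimes> k) ` F)" by (simp add: card_image)
  also have "\<dots> \<le> card (F <#> K)"
    using fin k by (intro card_mono) (auto simp: set_mult_def)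
  finally have cardFK: "card F \<le> card (F <#> K)" .
  have FK: "card (F <#> K) = card ((F <#> K) \<inter> F) + card ((F <#> K) - F)"
    using fin by (subst card_Un_disjoint[symmetric]) (auto intro!: arg_cong[of _ _ card])
  have F: "card F = card ((F <#> K) \<inter> F) + card (F - (F <#> K))"
    using fin by (subst card_Un_disjoint[symmetric]) (auto intro!: arg_cong[of _ _ card])
  have "F <#> K \<subseteq> D <#> K" using D(4) by (auto simp: set_mult_def)
  then have "card ((F <#> K) - F) \<le> card (((D <#> K) - D) \<union> (D - F))"
    using fin D(1) by (intro card_mono) auto
  also have "\<dots> \<le> card ((D <#> K) - D) + card (D - F)" by (rule card_Un_le)
  also have "card (D - F) = card D - card F" using D fin by (simp add: card_Diff_subset)
  finally have "real (card ((F <#> K) - F)) \<le> card ((D <#> K) - D) + (real (card D) - card F)"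
    using card_mono[OF D(1,4)] by linarith
  also have "\<dots> \<le> \<delta> * real (card D) + \<epsilon> * real (card D)"
    using D(5,6) by (simp add: algebra_simps)
  also have "\<dots> \<le> (\<delta> + \<epsilon>) * (2 * real (card F))"
    unfolding distrib_right[symmetric] using \<epsilon> half by (intro mult_left_mono) auto
  finally have 1: "real (card ((F <#> K) - F)) \<le> 2 * (\<delta> + \<epsilon>) * card F"
    by (simp add: algebra_simps)
  have "card (sym_diff (F <#> K) F) \<le> card ((F <#> K) - F) + card (F - (F <#> K))"
    by (rule card_Un_le)
  also have "\<dots> \<le> 2 * card ((F <#> K) - F)" using cardFK FK F by linarith
  finally have "real (card (sym_diff (F <#> K) F)) \<le> 2 * real (card ((F <#> K) - F))" by linarith
  also have "\<dots> \<le> 4 * (\<delta> + \<epsilon>) * card F"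
    using 1 by (simp add: algebra_simps)
  also have "\<dots> < \<eta> * card F"
    using \<epsilon>(4) ne fin by (intro mult_strict_right_mono) (auto simp: card_gt_0_iff)
  finally show ?thesis
    using ne fin sub by (simp add: KE_invariant_def divide_less_eq card_gt_0_iff)
qed

text \<open>Each base of a castle is replaced by a closed core; disjointness is inherited by
  subsets, and the lost mass is small for all means at once.\<close>

lemma closed_castle:
  assumes fol: "folner_sequence G F0" and free: "free_system G act" and sbp: "small_boundary_property G act"
    and \<eta>: "0 < \<eta>" and K: "finite K" "K \<noteq> {}" "K \<subseteq> carrier G"
  obtains S :: nat and B F where
    "\<And>s. s \<in> {1..S} \<Longrightarrow> closed (B s)" "\<And>s. s \<in> {1..S} \<Longrightarrow> KE_invariant G K \<eta> (F s)"
    "disjoint_family_on (\<lambda>(s, g). (\<lambda>x. act x g) ` B s) (SIGMA s:{1..S}. F s)"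
    "\<And>m. mean m \<Longrightarrow> m (- (\<Union>s\<in>{1..S}. \<Union>g\<in>F s. (\<lambda>x. act x g) ` B s)) \<le> \<eta> / 2"
proof -
  \<comment> \<open>With these constants \<open>KE_invariant_trim\<close> yields
    \<open>\<eta>\<close>, and the castle misses at most \<open>\<eta> / 8\<close>; passing to cores
    costs at most another \<open>\<eta> / 4\<close>.\<close>
  define \<epsilon> where "\<epsilon> = min (1/2) (\<eta> / 16)"
  define \<delta> where "\<delta> = \<eta> / 16"
  have \<epsilon>: "0 < \<epsilon>" "\<epsilon> \<le> 1/2" "\<epsilon> \<le> \<eta> / 16" and \<delta>: "0 < \<delta>" using \<eta> by (auto simp: \<epsilon>_def \<delta>_def)
  obtain n where n: "(1 - \<epsilon>) ^ n < \<eta> / 16"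
    using real_arch_pow_inv[of "\<eta> / 16" "1 - \<epsilon>"] \<eta> \<epsilon> by auto
  obtain T where T: "castle \<epsilon> K \<delta> T"
    and mT: "\<And>m. mean m \<Longrightarrow> m (- castle_cover T) \<le> (1 - \<epsilon>) ^ n + \<delta>"
    using exists_castle[OF fol free sbp \<epsilon>(1,2) K(1,3) \<delta>] by blast
  have finT: "finite T" by (rule castle_finite[OF T])
  \<comment> \<open>Each level of each tower loses at most \<open>\<theta>\<close>, and
    \<open>N\<close> counts the levels; \<open>Suc N\<close> keeps the denominator positive.\<close>
  define N where "N = (\<Sum>(W, D, F)\<in>T. card F)"
  define \<theta> where "\<theta> = \<eta> / (4 * real (Suc N))"
  have \<theta>: "0 < \<theta>" using \<eta> by (simp add: \<theta>_def)
  have "\<forall>p\<in>T. \<exists>B. closed B \<and> B \<subseteq> fst p \<and> (\<forall>m. mean m \<longrightarrow> m (fst p - B) \<le> \<theta>)"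
  proof
    fix p assume "p \<in> T"
    then have "boundary_null (fst p)" using castle_tower(1)[OF T, of "fst p" "fst (snd p)" "snd (snd p)"] by simp
    then show "\<exists>B. closed B \<and> B \<subseteq> fst p \<and> (\<forall>m. mean m \<longrightarrow> m (fst p - B) \<le> \<theta>)"
      using \<theta> by (rule boundary_null_closed_core)
  qed
  then obtain core where core: "\<And>p. p \<in> T \<Longrightarrow> closed (core p)" "\<And>p. p \<in> T \<Longrightarrow> core p \<subseteq> fst p"
    "\<And>p m. p \<in> T \<Longrightarrow> mean m \<Longrightarrow> m (fst p - core p) \<le> \<theta>" by metis
  obtain t where t: "bij_betw t {1..card T} T"
    using ex_bij_betw_nat_finite_1[OF finT] by blast
  have tT: "t s \<in> T" if "s \<in> {1..card T}" for s using bij_betwE[OF t] that by blast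
  have t_img: "t ` {1..card T} = T" using t by (simp add: bij_betw_def)
  define B where "B s = core (t s)" for s
  define F where "F s = snd (snd (t s))" for s
  have Fsub: "F s \<subseteq> carrier G" "finite (F s)" if "s \<in> {1..card T}" for s
    using castle_tower(2,4,5)[OF T, of "fst (t s)" "fst (snd (t s))" "snd (snd (t s))"] tT[OF that]
    by (auto simp: F_def intro: finite_subset)
  show thesis
  proof (rule that)
    show "closed (B s)" if "s \<in> {1..card T}" for s
      using core(1)[OF tT[OF that]] by (simp add: B_def)
    show "KE_invariant G K \<eta> (F s)" if "s \<in> {1..card T}" for s
    proof -
      have p: "(fst (t s), fst (snd (t s)), snd (snd (t s))) \<in> T" using tT[OF that] by simp
      have "4 * (\<delta> + \<epsilon>) < \<eta>" using \<epsilon>(3) \<eta> by (simp add: \<delta>_def)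
      then show ?thesis
        unfolding F_def using castle_tower[OF T p] K \<epsilon> \<delta>
        by (intro KE_invariant_trim[of "fst (snd (t s))" _ \<epsilon> K \<delta> \<eta>]) auto
    qed
    show "disjoint_family_on (\<lambda>(s, g). (\<lambda>x. act x g) ` B s) (SIGMA s:{1..card T}. F s)"
      unfolding disjoint_family_on_def
    proof (intro ballI impI)
      fix a b assume ab: "a \<in> (SIGMA s:{1..card T}. F s)" "b \<in> (SIGMA s:{1..card T}. F s)" "a \<noteq> b"
      obtain s g where a: "a = (s, g)" by (cases a)
      obtain r h where b: "b = (r, h)" by (cases b)
      have mem: "s \<in> {1..card T}" "g \<in> F s" "r \<in> {1..card T}" "h \<in> F r" using ab by (auto simp: a b)
      have "act w g \<noteq> act v h" if w: "w \<in> B s" "v \<in> B r" for w v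
      proof
        assume "act w g = act v h"
        moreover have "w \<in> fst (t s)" "v \<in> fst (t r)"
          using w core(2)[OF tT[OF mem(1)]] core(2)[OF tT[OF mem(3)]] by (auto simp: B_def)
        ultimately have "t s = t r \<and> g = h"
          using castle_disjoint[OF T, of "fst (t s)" "fst (snd (t s))" "snd (snd (t s))"
              "fst (t r)" "fst (snd (t r))" "snd (snd (t r))" w v g h] mem tT
          by (simp add: F_def)
        then show False
          using inj_onD[OF bij_betw_imp_inj_on[OF t], of s r] mem ab(3) by (simp add: a b)
      qed
      then show "(case a of (s, g) \<Rightarrow> (\<lambda>x. act x g) ` B s) \<inter> (case b of (s, g) \<Rightarrow> (\<lambda>x. act x g) ` B s) = {}"
        by (auto simp: a b)
    qed
    fix m assume m: "mean m"
    interpret finadd_prob m by (rule mean_finadd[OF m])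
    let ?I = "SIGMA p:T. snd (snd p)"
    let ?E = "\<lambda>(p, g). (\<lambda>x. act x g) ` (fst p - core p)"
    have fin: "finite (snd (snd p))" and sub: "snd (snd p) \<subseteq> carrier G" if "p \<in> T" for p
      using castle_tower(2,4,5)[OF T, of "fst p" "fst (snd p)" "snd (snd p)"] that
        finite_subset[of "snd (snd p)" "fst (snd p)"] by auto
    let ?C = "\<Union>s\<in>{1..card T}. \<Union>g\<in>F s. (\<lambda>x. act x g) ` B s"
    have "?C = (\<Union>p\<in>t ` {1..card T}. \<Union>g\<in>snd (snd p). (\<lambda>x. act x g) ` core p)"
      by (simp add: B_def F_def)
    then have C: "?C = (\<Union>p\<in>T. \<Union>g\<in>snd (snd p). (\<lambda>x. act x g) ` core p)"
      by (simp only: t_img)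
    have "- ?C \<subseteq> - castle_cover T \<union> (\<Union>i\<in>?I. ?E i)"
    proof
      fix y assume y: "y \<in> - ?C"
      show "y \<in> - castle_cover T \<union> (\<Union>i\<in>?I. ?E i)"
      proof (cases "y \<in> castle_cover T")
        case True
        then obtain W D F' w g where p: "(W, D, F') \<in> T" "w \<in> W" "g \<in> F'" "y = act w g"
          by (auto simp: castle_cover_def translates_def)
        have "y \<in> ?C" if "w \<in> core (W, D, F')"
          unfolding C using p that by (intro UN_I[of "(W, D, F')"] UN_I[of g]) auto
        then have "w \<notin> core (W, D, F')" using y by blast
        then have "((W, D, F'), g) \<in> ?I" "y \<in> ?E ((W, D, F'), g)" using p by auto
        then show ?thesis by (intro UnI2) (rule UN_I)
      qed simp
    qed
    then have "m (- ?C) \<le> m (- castle_cover T \<union> (\<Union>i\<in>?I. ?E i))" by (rule mono)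
    also have "\<dots> \<le> m (- castle_cover T) + m (\<Union>i\<in>?I. ?E i)" by (rule Un_le)
    also have "m (\<Union>i\<in>?I. ?E i) \<le> (\<Sum>i\<in>?I. m (?E i))"
      using finT fin by (intro UN_le finite_SigmaI)
    also have "\<dots> = (\<Sum>p\<in>T. \<Sum>g\<in>snd (snd p). m (?E (p, g)))"
      using finT fin by (subst sum.Sigma) (auto simp: split_def)
    also have "\<dots> \<le> (\<Sum>p\<in>T. \<Sum>g\<in>snd (snd p). \<theta>)"
      using sub core(3)[OF _ m] by (intro sum_mono) (auto simp: mean_image[OF m] subset_iff)
    also have "\<dots> = N * \<theta>"
      by (simp add: N_def split_def sum_distrib_right)
    also have "\<dots> \<le> \<eta> / 4"
      using \<eta> by (simp add: \<theta>_def field_simps)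
    finally have "m (- ?C) \<le> m (- castle_cover T) + \<eta> / 4" by simp
    also have "\<dots> \<le> \<eta> / 2"
      using mT[OF m] n \<eta> unfolding \<delta>_def by linarith
    finally show "m (- ?C) \<le> \<eta> / 2" .
  qed
qed

end

text \<open>Bases are pulled back along \<open>\<pi>\<close> and shapes stay the same. The
  push-forward of a mean for \<open>act\<close> is a mean for \<open>act'\<close>, so the bound for
  the uncovered part transfers and \<open>ocap_le\<close> concludes.\<close>

lemma URP_extension:
  fixes act :: "'x::metric_space \<Rightarrow> 'g \<Rightarrow> 'x" and act' :: "'y::metric_space \<Rightarrow> 'g \<Rightarrow> 'y"
  assumes X: "dynamics G act" and Y: "dynamics G act'" and am: "amenable_group G"
    and ext: "extension_of G act act'"
    and free: "free_system G act'" and sbp: "small_boundary_property G act'"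
  shows "URP G act"
  unfolding URP_def
proof (intro allI impI, elim conjE)
  fix \<eta> :: real and K assume \<eta>: "\<eta> > 0" and K: "finite K" "K \<noteq> {}" "K \<subseteq> carrier G"
  interpret X: dynamics G act by (rule X)
  interpret Y: dynamics G act' by (rule Y)
  obtain F0 where fol: "folner_sequence G F0" using am by (auto simp: amenable_group_def)
  obtain \<pi> where \<pi>: "continuous_on UNIV \<pi>" "surj \<pi>" "\<And>x g. g \<in> carrier G \<Longrightarrow> \<pi> (act x g) = act' (\<pi> x) g"
    using ext by (auto simp: extension_of_def)
  obtain S B F where closed: "\<And>s. s \<in> {1..S::nat} \<Longrightarrow> closed (B s)"
    and KE: "\<And>s. s \<in> {1..S} \<Longrightarrow> KE_invariant G K \<eta> (F s)"
    and disj: "disjoint_family_on (\<lambda>(s, g). (\<lambda>x. act' x g) ` B s) (SIGMA s:{1..S}. F s)"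
    and small: "\<And>m. Y.mean m \<Longrightarrow> m (- (\<Union>s\<in>{1..S}. \<Union>g\<in>F s. (\<lambda>x. act' x g) ` B s)) \<le> \<eta> / 2"
    using Y.closed_castle[OF fol free sbp \<eta> K] by blast
  have Fsub: "g \<in> carrier G" if "s \<in> {1..S}" "g \<in> F s" for s g
    using KE that by (auto simp: KE_invariant_def)
  \<comment> \<open>Equivariance alone gives an inclusion; writing both images as preimages under
    the inverse element gives equality.\<close>
  have img: "(\<lambda>x. act x g) ` (\<pi> -` A) = \<pi> -` ((\<lambda>x. act' x g) ` A)" if "g \<in> carrier G" for g A
    using that by (auto simp: X.act_image Y.act_image \<pi>(3))
  define R where "R = - (\<Union>s\<in>{1..S}. \<Union>g\<in>F s. (\<lambda>x. act' x g) ` B s)"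
  have eq: "(\<Union>s\<in>{1..S}. \<Union>g\<in>F s. (\<lambda>x. act x g) ` (\<pi> -` B s)) =
      (\<Union>s\<in>{1..S}. \<Union>g\<in>F s. \<pi> -` ((\<lambda>x. act' x g) ` B s))"
    using img Fsub by (intro SUP_cong refl) auto
  have rem: "UNIV - (\<Union>s\<in>{1..S}. \<Union>g\<in>F s. (\<lambda>x. act x g) ` (\<pi> -` B s)) = \<pi> -` R"
    by (simp only: eq R_def vimage_UN vimage_Diff vimage_UNIV Compl_eq_Diff_UNIV)
  have "m (\<pi> -` R) \<le> \<eta> / 2" if m: "X.mean m" for m
  proof -
    have "Y.mean (\<lambda>A. m (\<pi> -` A))"
      unfolding invariant_mean_def
    proof (intro conjI ballI allI)
      interpret finadd_prob m by (rule X.mean_finadd[OF m])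
      show "finadd_prob (\<lambda>A. m (\<pi> -` A))"
      proof
        fix A C :: "'y set" assume "A \<inter> C = {}"
        then have "\<pi> -` A \<inter> \<pi> -` C = {}" by auto
        then show "m (\<pi> -` (A \<union> C)) = m (\<pi> -` A) + m (\<pi> -` C)"
          unfolding vimage_Un by (rule additive)
      qed (simp_all add: nonneg total)
      fix g A assume g: "g \<in> carrier G"
      have "\<pi> -` (\<lambda>x. act' x g) -` A = (\<lambda>x. act x g) -` \<pi> -` A" using g by (auto simp: \<pi>(3))
      then show "m (\<pi> -` (\<lambda>x. act' x g) -` A) = m (\<pi> -` A)"
        using X.mean_vimage[OF m g] by simp
    qed
    then show ?thesis using small unfolding R_def by blast
  qed
  then have "ocap G act (\<pi> -` R) \<le> \<eta> / 2" by (rule X.ocap_le[OF fol])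
  then have "ocap G act (\<pi> -` R) < \<eta>" using \<eta> by simp
  moreover have "closed (\<pi> -` B s)" if "s \<in> {1..S}" for s
    using closed_vimage[OF closed[OF that] \<pi>(1)] .
  moreover have "disjoint_family_on (\<lambda>(s, g). (\<lambda>x. act x g) ` (\<pi> -` B s)) (SIGMA s:{1..S}. F s)"
    unfolding disjoint_family_on_def
  proof (intro ballI impI)
    fix a b assume ab: "a \<in> (SIGMA s:{1..S}. F s)" "b \<in> (SIGMA s:{1..S}. F s)" "a \<noteq> b"
    obtain s g where a: "a = (s, g)" by (cases a)
    obtain r h where b: "b = (r, h)" by (cases b)
    have "(\<lambda>x. act' x g) ` B s \<inter> (\<lambda>x. act' x h) ` B r = {}"
      using disjoint_family_onD[OF disj ab] by (simp add: a b)
    then have "\<pi> -` ((\<lambda>x. act' x g) ` B s) \<inter> \<pi> -` ((\<lambda>x. act' x h) ` B r) = {}"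
      unfolding vimage_Int[symmetric] by simp
    moreover have "g \<in> carrier G" "h \<in> carrier G" using ab Fsub by (auto simp: a b)
    ultimately show "(case a of (s, g) \<Rightarrow> (\<lambda>x. act x g) ` (\<pi> -` B s)) \<inter>
        (case b of (s, g) \<Rightarrow> (\<lambda>x. act x g) ` (\<pi> -` B s)) = {}"
      by (simp add: a b img)
  qed
  ultimately show "\<exists>(S::nat) (B :: nat \<Rightarrow> 'x set) (F :: nat \<Rightarrow> 'g set).
      (\<forall>s\<in>{1..S}. closed (B s) \<and> KE_invariant G K \<eta> (F s)) \<and>
      disjoint_family_on (\<lambda>(s, g). (\<lambda>x. act x g) ` B s) (SIGMA s:{1..S}. F s) \<and>
      ocap G act (UNIV - (\<Union>s\<in>{1..S}. \<Union>g\<in>F s. (\<lambda>x. act x g) ` B s)) < \<eta>"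
    using KE rem by (intro exI[of _ S] exI[of _ "\<lambda>s. \<pi> -` B s"] exI[of _ F]) auto
qed

section \<open>Clopen bases and Cantor systems\<close>

lemma clopen_basis_Cantor:
  fixes U :: "(nat \<Rightarrow> bool) set"
  assumes "open U" "x \<in> U"
  obtains V where "open V" "closed V" "x \<in> V" "V \<subseteq> U"
proof -
  have "openin (product_topology (\<lambda>_. euclidean) UNIV) U"
    using assms(1) by (simp add: open_fun_def)
  from product_topology_open_contains_basis[OF this assms(2)]
  obtain X where X: "x \<in> (\<Pi>\<^sub>E i\<in>UNIV. X i)" "\<And>i. openin euclidean (X i)"
      "finite {i. X i \<noteq> topspace euclidean}" "(\<Pi>\<^sub>E i\<in>UNIV. X i) \<subseteq> U"
    by blast
  \<comment> \<open>Every subset of the finite space \<open>bool\<close> is closed, so a box is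
    closed whatever its factors; openness uses that only finitely many coordinates are
    restricted.\<close>
  have "closed (\<Inter>i. (\<lambda>f :: nat \<Rightarrow> bool. f i) -` X i)"
    by (intro closed_INT ballI closed_vimage continuous_on_product_coordinates finite_imp_closed) simp
  moreover have "(\<Pi>\<^sub>E i\<in>UNIV. X i) = (\<Inter>i. (\<lambda>f. f i) -` X i)"
    by (auto simp: PiE_UNIV_domain)
  ultimately have "closed (\<Pi>\<^sub>E i\<in>UNIV. X i)" by simp
  moreover have "open (\<Pi>\<^sub>E i\<in>UNIV. X i)"
    using X by (intro open_PiE) auto
  ultimately show thesis using X that by blast
qed

lemma cantor_small_boundary:
  fixes act :: "'y::metric_space \<Rightarrow> 'g \<Rightarrow> 'y"
  assumes "cantor_system act"
  shows "small_boundary_property G act"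
proof -
  obtain f :: "'y \<Rightarrow> nat \<Rightarrow> bool" and k where h: "homeomorphism UNIV UNIV f k"
    using assms by (auto simp: cantor_system_def homeomorphic_def)
  have cont: "continuous_on UNIV f" "continuous_on UNIV k" and kf: "k (f x) = x" and fk: "f (k z) = z" for x z
    using h by (auto simp: homeomorphism_def)
  have "topological_basis {V :: 'y set. open V \<and> closed V}"
  proof (rule topological_basisI)
    fix U :: "'y set" and x assume U: "open U" "x \<in> U"
    have "open (k -` U)" "f x \<in> k -` U" using U cont by (auto simp: kf intro: open_vimage)
    then obtain V where V: "open V" "closed V" "f x \<in> V" "V \<subseteq> k -` U"
      by (rule clopen_basis_Cantor)
    have "open (f -` V)" "closed (f -` V)" using V cont by (auto intro: open_vimage closed_vimage)
    moreover have "f -` V \<subseteq> U" using V(4) by (auto simp: kf dest!: subsetD)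
    ultimately show "\<exists>V\<in>{V. open V \<and> closed V}. x \<in> V \<and> V \<subseteq> U"
      using V(3) by (intro bexI[of _ "f -` V"]) auto
  qed auto
  then show ?thesis
    unfolding small_boundary_property_def
    by (intro exI[of _ "{V. open V \<and> closed V}"]) (auto simp: frontier_def interior_open)
qed

theorem corollary3p8:
  fixes G :: "('g, 'm) monoid_scheme"
    and act :: "'x::metric_space \<Rightarrow> 'g \<Rightarrow> 'x"
    and act' :: "'y::metric_space \<Rightarrow> 'g \<Rightarrow> 'y"
  assumes "group G" and "countable (carrier G)" and "amenable_group G"
    and "dyn_system G act" and "dyn_system G act'"
    and "extension_of G act act'"
  shows "(free_system G act' \<and> small_boundary_property G act' \<longrightarrow> URP G act) \<and>
         (free_system G act' \<and> minimal_system G act' \<and> cantor_system act' \<longrightarrow> URP G act)"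
proof -
  have "dynamics G act" "dynamics G act'"
    using assms by (simp_all add: dynamics_def dynamics_axioms_def)
  then have "free_system G act' \<Longrightarrow> small_boundary_property G act' \<Longrightarrow> URP G act"
    using URP_extension assms(3,6) by blast
  then show ?thesis using cantor_small_boundary by blast
qed

end
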